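(* Let $p>3$ be prime, $0\le m\le p-1$, and let $A=\begin{pmatrix} a&k\\ p&d\end{pmatrix}\in\Gamma_0(p)$ with $1\le a,d\le p-1$. Then $$\big(\mathcal{K}^{(C)}_{p,m}(\zeta_p,z)\big)\big|[A]_1=\frac{\sin(\pi/p)}{\sin(d\pi/p)}\,(-1)^{d+1}\,\zeta_p^{mak}\,\mathcal{K}^{(C)}_{p,ma^2}(\zeta_p^{d},z).$$
   Context: $z$ in the upper half-plane, $q=e^{2\pi i z}$, $q^r=e^{2\pi i r z}$, $\zeta_p=e^{2\pi i/p}$, $(a;q)_\infty=\prod_{k\ge0}(1-aq^k)$; $(F|[A]_1)(z)=(cz+d)^{-1}F\big(\tfrac{az+b}{cz+d}\big)$ for $A=\begin{pmatrix} a&b\\ c&d\end{pmatrix}$. Crank generating function: $C(x,q)=\frac{(q;q)_\infty}{(xq;q)_\infty(x^{-1}q;q)_\infty}$. For $1\le\ell\le p-1$ write $C(\zeta_p^\ell,q)=\sum_{n\ge0}c_\ell(n)q^n$, $c_\ell(n)=0$ for $n<0$ (equivalently $c_\ell(n)=\sum_{k=0}^{p-1}M(k,p,n)\zeta_p^{k\ell}$ with $M(k,p,n)$ the number of partitions of $n$ with crank $\equiv k\pmod p$, generating-function convention at $n=1$). With $s_p=\frac{p^2-1}{24}$, for any integer $m$ define $\mathcal{K}^{(C)}_{p,m}(\zeta_p^{\ell},z)=q^{m/p}\prod_{n\ge1}(1-q^{pn})\sum_{n\in\mathbb{Z}}c_\ell(pn+m-s_p)\,q^n$; this depends only on $m$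 modulo $p$. *)

theory Defs
  imports "HOL-Analysis.Analysis" "HOL-Computational_Algebra.Formal_Power_Series"
begin

definition zeta :: "nat \<Rightarrow> complex" where
  "zeta p = exp (2 * pi * \<i> / of_nat p)"

definition qpow :: "complex \<Rightarrow> complex \<Rightarrow> complex" where
  "qpow z r = exp (2 * pi * \<i> * r * z)"

text \<open>Truncation of the crank generating function
  C(x,q) = (q;q)_inf / ((xq;q)_inf (x^{-1}q;q)_inf) as a formal power series in q,
  keeping the factors with exponent k \<le> N; the coefficient of q^N is
  unaffected by the omitted factors (each is 1 + O(q^k), k > N).\<close>
definition crank_fps_trunc :: "complex \<Rightarrow> nat \<Rightarrow> complex fps" where
  "crank_fps_trunc x N =
     (\<Prod>k\<in>{1..N}. (1 - fps_X ^ k)) *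
     inverse (\<Prod>k\<in>{1..N}. (1 - fps_const x * fps_X ^ k) * (1 - fps_const (inverse x) * fps_X ^ k))"

definition crank_coeff :: "complex \<Rightarrow> int \<Rightarrow> complex" where
  "crank_coeff x n = (if n < 0 then 0 else fps_nth (crank_fps_trunc x (nat n)) (nat n))"

definition s_p :: "nat \<Rightarrow> int" where
  "s_p p = (int p ^ 2 - 1) div 24"

definition K_crank :: "nat \<Rightarrow> int \<Rightarrow> complex \<Rightarrow> complex \<Rightarrow> complex" where
  "K_crank p m x z =
     qpow z (of_int m / of_nat p) *
     (\<Prod>n. 1 - qpow z (of_nat (p * Suc n))) *
     (\<Sum>\<^sub>\<infinity>n\<in>(UNIV::int set). crank_coeff x (int p * n + m - s_p p) * qpow z (of_int n))"

definition slash1 :: "int \<Rightarrow> int \<Rightarrow> int \<Rightarrow> int \<Rightarrow> (complex \<Rightarrow> complex) \<Rightarrow> complex \<Rightarrow> complex" where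
  "slash1 a b c d F z = inverse (of_int c * z + of_int d) * F ((of_int a * z + of_int b) / (of_int c * z + of_int d))"

end

theory Submission
  imports Defs "HOL-Complex_Analysis.Complex_Analysis"
begin

text \<open>
  The quotient \<open>\<theta>\<^sub>1(v; z) / \<eta>(z)\<^sup>3\<close> (called \<open>jac\<close>) transforms under all of \<open>SL\<^sub>2(\<int>)\<close> without a
  multiplier: after the obvious correction by a Gaussian factor, the two sides of the transformation
  law have the same simple zeros and the same quasi-periods in \<open>v\<close>, so their quotient is constant by
  Liouville. Its values at the 2-torsion points yield the modularity of \<open>\<eta>\<^sup>2\<^sup>4\<close>, and

  \<open>\<eta>(p\<^sup>2 z) / \<eta>(z) = const * (\<eta>(z)\<^sup>2\<^sup>4)\<^sup>s * P(p z) * P(z)\<^sup>p\<close>  with  \<open>P(z) = \<Prod>\<^sub>l jac (l / p) z = const * \<eta>(p z) / \<eta>(z)\<^sup>p\<close>,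

  \<open>1 \<le> l \<le> (p - 1) / 2\<close> and \<open>s = (p\<^sup>2 - 1) / 24\<close>, shows that \<open>\<eta>(p\<^sup>2 z) / \<eta>(z)\<close> is invariant under the
  matrices of \<open>\<Gamma>\<^sub>0(p\<^sup>2)\<close> that occur: the Gauss lemma sign arises \<open>p + 1\<close> times and cancels. Hence
  \<open>G\<^sub>l(z) = q\<^sup>s \<Prod>(1 - q\<^bsup>p\<^sup>2n\<^esup>) C(\<zeta>\<^sup>l, q)\<close>, which is \<open>2 \<i> sin (\<pi> l / p) \<eta>(p\<^sup>2 z) / \<eta>(z) / jac (l / p) z\<close>,
  satisfies an explicit transformation law of weight 1. Finally \<open>K\<^sub>p\<^sub>,\<^sub>m(\<zeta>\<^sup>l, z)\<close> is the average of
  \<open>\<zeta>\<^bsup>-mj\<^esup> G\<^sub>l((z + j) / p)\<close> over \<open>j\<close> mod \<open>p\<close>, and \<open>A\<close> permutes these terms.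
\<close>

section \<open>The infinite q-Pochhammer symbol\<close>

definition qpoch :: "complex \<Rightarrow> complex \<Rightarrow> complex" where
  "qpoch x q = (\<Prod>k. 1 - x * q ^ k)"

lemma convergent_prod_qpoch:
  fixes x q :: complex
  assumes "norm q < 1"
  shows "convergent_prod (\<lambda>k. 1 - x * q ^ k)"
proof (rule abs_convergent_prod_imp_convergent_prod)
  have "summable (\<lambda>k. norm x * norm q ^ k)"
    using assms by (intro summable_mult summable_geometric) auto
  thus "abs_convergent_prod (\<lambda>k. 1 - x * q ^ k)"
    unfolding abs_convergent_prod_conv_summable by (simp add: norm_mult norm_power)
qed

lemma has_prod_qpoch:
  fixes x q :: complex
  assumes "norm q < 1"
  shows "(\<lambda>k. 1 - x * q ^ k) has_prod qpoch x q"
  using convergent_prod_has_prod[OF convergent_prod_qpoch[OF assms]] by (simp add: qpoch_def)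

lemma qpoch_LIMSEQ:
  fixes x q :: complex
  assumes "norm q < 1"
  shows "(\<lambda>N. \<Prod>k<N. 1 - x * q ^ k) \<longlonglongrightarrow> qpoch x q"
  using has_prod_imp_tendsto'[OF has_prod_qpoch[OF assms]] .

lemma qpoch_eq_0_iff:
  fixes x q :: complex
  assumes "norm q < 1"
  shows "qpoch x q = 0 \<longleftrightarrow> (\<exists>k. x * q ^ k = 1)"
  using has_prod_eq_0_iff[OF has_prod_qpoch[OF assms]] by (metis (no_types, lifting) eq_iff_diff_eq_0 rangeE rangeI)

lemma qpoch_neq_0:
  assumes "norm q < 1" "norm x < 1"
  shows "qpoch x q \<noteq> 0"
proof -
  have "norm (x * q ^ k) < 1" for k
  proof -
    have "norm x * norm q ^ k \<le> norm x * 1"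
      using assms by (intro mult_left_mono power_le_one) auto
    thus ?thesis using assms by (simp add: norm_mult norm_power)
  qed
  thus ?thesis using qpoch_eq_0_iff[OF assms(1)] by (metis norm_one less_irrefl)
qed

lemma qpoch_rec:
  fixes x q :: complex
  assumes "norm q < 1"
  shows "qpoch x q = (1 - x) * qpoch (x * q) q"
proof -
  have "(\<lambda>k. 1 - x * q ^ k) has_prod ((\<Prod>k<1. 1 - x * q ^ k) * (\<Prod>k. 1 - x * q ^ (k + 1)))"
    by (rule has_prod_ignore_initial_segment') (rule convergent_prod_qpoch[OF assms])
  hence "qpoch x q = (1 - x) * (\<Prod>k. 1 - x * q ^ (k + 1))"
    using has_prod_unique2[OF has_prod_qpoch[OF assms]] by simp
  thus ?thesis by (simp add: qpoch_def mult_ac)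
qed

text \<open>Weierstrass M-test: on a compact set \<open>norm (X t)\<close> and
  \<open>norm (Q t)\<close> attain their maxima, and these give one dominating geometric series.
  Base and argument both vary, so the result serves for holomorphy in the elliptic variable as well
  as in \<open>q\<close>.\<close>

lemma uniform_limit_qpoch:
  fixes X Q :: "complex \<Rightarrow> complex"
  assumes "compact A" and cont: "continuous_on A X" "continuous_on A Q"
    and less1: "\<And>t. t \<in> A \<Longrightarrow> norm (Q t) < 1"
  shows "uniform_limit A (\<lambda>N t. \<Prod>k<N. 1 - X t * Q t ^ k) (\<lambda>t. qpoch (X t) (Q t)) sequentially"
proof (cases "A = {}")
  case False
  obtain t0 where t0: "t0 \<in> A" "\<And>t. t \<in> A \<Longrightarrow> norm (Q t) \<le> norm (Q t0)"
    using continuous_attains_sup[OF assms(1) False, of "\<lambda>t. norm (Q t)"] cont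
    by (auto intro: continuous_intros)
  obtain t1 where t1: "t1 \<in> A" "\<And>t. t \<in> A \<Longrightarrow> norm (X t) \<le> norm (X t1)"
    using continuous_attains_sup[OF assms(1) False, of "\<lambda>t. norm (X t)"] cont
    by (auto intro: continuous_intros)
  have "uniformly_convergent_on A (\<lambda>N t. \<Prod>k<N. 1 - X t * Q t ^ k)"
  proof (rule uniformly_convergent_on_prod')
    show "uniformly_convergent_on A (\<lambda>N t. \<Sum>n<N. norm (1 - X t * Q t ^ n - 1))"
    proof (rule Weierstrass_m_test')
      show "summable (\<lambda>k. norm (X t1) * norm (Q t0) ^ k)"
        using less1[OF t0(1)] by (intro summable_mult summable_geometric) auto
      show "norm (norm (1 - X t * Q t ^ n - 1)) \<le> norm (X t1) * norm (Q t0) ^ n" if "t \<in> A" for n t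
        using that t0 t1 by (auto simp: norm_mult norm_power intro!: mult_mono power_mono)
    qed
  qed (use assms in \<open>auto intro!: continuous_intros\<close>)
  then obtain g where g: "uniform_limit A (\<lambda>N t. \<Prod>k<N. 1 - X t * Q t ^ k) g sequentially"
    by (auto simp: uniformly_convergent_on_def)
  have "g t = qpoch (X t) (Q t)" if "t \<in> A" for t
    using tendsto_uniform_limitI[OF g that] qpoch_LIMSEQ[OF less1[OF that]] LIMSEQ_unique by blast
  thus ?thesis using g by (metis (mono_tags, lifting) uniform_limit_cong')
qed auto

lemma holomorphic_on_qpoch:
  fixes X Q :: "complex \<Rightarrow> complex"
  assumes "X holomorphic_on A" "Q holomorphic_on A" "open A"
    and less1: "\<And>t. t \<in> A \<Longrightarrow> norm (Q t) < 1"
  shows "(\<lambda>t. qpoch (X t) (Q t)) holomorphic_on A"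
proof (rule holomorphic_uniform_sequence[OF \<open>open A\<close>])
  show "(\<lambda>t. \<Prod>k<n. 1 - X t * Q t ^ k) holomorphic_on A" for n
    by (intro holomorphic_intros assms)
  show "\<exists>d>0. cball x d \<subseteq> A \<and> uniform_limit (cball x d) (\<lambda>n t. \<Prod>k<n. 1 - X t * Q t ^ k)
          (\<lambda>t. qpoch (X t) (Q t)) sequentially" if x: "x \<in> A" for x
  proof -
    obtain d where d: "d > 0" "cball x d \<subseteq> A"
      using \<open>open A\<close> x open_contains_cball by blast
    moreover have "uniform_limit (cball x d) (\<lambda>n t. \<Prod>k<n. 1 - X t * Q t ^ k)
          (\<lambda>t. qpoch (X t) (Q t)) sequentially"
      using d assms by (intro uniform_limit_qpoch)
        (auto intro: holomorphic_on_imp_continuous_on continuous_on_subset)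
    ultimately show ?thesis by blast
  qed
qed

lemma continuous_on_qpoch: "norm q < 1 \<Longrightarrow> continuous_on A (\<lambda>x. qpoch x q)"
  using holomorphic_on_qpoch[of "\<lambda>x. x" UNIV "\<lambda>_. q"]
  by (auto intro!: holomorphic_intros holomorphic_on_imp_continuous_on intro: continuous_on_subset)

section \<open>The Jacobi form of weight -1 and index 1/2\<close>

definition ee :: "complex \<Rightarrow> complex" where
  "ee w = exp (2 * pi * \<i> * w)"

lemma ee_add: "ee (a + b) = ee a * ee b"
  by (simp add: ee_def ring_distribs exp_add del: mult_exp_exp)

lemma ee_neq_0 [simp]: "ee a \<noteq> 0"
  by (simp add: ee_def)

lemma ee_minus: "ee (- a) = inverse (ee a)"
  by (simp add: ee_def exp_minus)

lemma ee_diff: "ee (a - b) = ee a / ee b"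
  using ee_add[of a "- b"] by (simp add: ee_minus field_simps)

lemma ee_power: "ee a ^ n = ee (of_nat n * a)"
  by (simp add: ee_def exp_of_nat_mult[symmetric] mult_ac)

lemma ee_0 [simp]: "ee 0 = 1"
  by (simp add: ee_def)

lemma ee_eq_1_iff: "ee a = 1 \<longleftrightarrow> (\<exists>n::int. a = of_int n)"
  unfolding ee_def exp_eq_1 by (auto simp: complex_eq_iff)

lemma ee_of_int [simp]: "ee (of_int n) = 1"
  by (auto simp: ee_eq_1_iff)

lemma ee_1 [simp]: "ee 1 = 1"
  using ee_of_int[of 1] by simp

lemma ee_half: "ee (1 / 2) = - 1"
  by (simp add: ee_def)

lemma ee_half_int: "ee (of_int n / 2) = (-1) powi n"
proof (cases "n \<ge> 0")
  case True
  then obtain k where k: "n = int k" using nonneg_int_cases by blast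
  show ?thesis using ee_power[of "1 / 2" k] by (simp add: k ee_half)
next
  case False
  define k where "k = nat (- n)"
  have k: "n = - int k" using False by (simp add: k_def)
  show ?thesis using ee_power[of "1 / 2" k] by (simp add: k ee_half ee_minus power_int_minus)
qed

lemma norm_ee_less_1: "Im z > 0 \<Longrightarrow> norm (ee z) < 1"
  by (simp add: ee_def)

lemma holomorphic_on_ee [holomorphic_intros]:
  "f holomorphic_on A \<Longrightarrow> (\<lambda>t. ee (f t)) holomorphic_on A"
  unfolding ee_def by (intro holomorphic_intros)

lemma tendsto_ee [tendsto_intros]:
  "(f \<longlongrightarrow> l) F \<Longrightarrow> ((\<lambda>t. ee (f t)) \<longlongrightarrow> ee l) F"
  unfolding ee_def by (intro tendsto_intros)

definition euler_prod :: "complex \<Rightarrow> complex" where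
  "euler_prod z = qpoch (ee z) (ee z)"

lemma euler_prod_neq_0: "Im z > 0 \<Longrightarrow> euler_prod z \<noteq> 0"
  unfolding euler_prod_def by (intro qpoch_neq_0 norm_ee_less_1)

text \<open>This is \<open>\<theta>\<^sub>1(v; z) / \<eta>(z)\<^sup>3\<close>, normalised so that its derivative in \<open>v\<close> at 0 is \<open>2 \<pi> \<i>\<close>.\<close>
definition jac :: "complex \<Rightarrow> complex \<Rightarrow> complex" where
  "jac v z = - ee (- v / 2) * qpoch (ee v) (ee z) * qpoch (ee (z - v)) (ee z) / euler_prod z ^ 2"

lemma jac_plus_1: "jac (v + 1) z = - jac v z"
proof -
  have "ee (- (v + 1) / 2) = - ee (- v / 2)"
    using ee_diff[of "- v / 2" "1 / 2"] by (simp add: ee_half diff_divide_distrib)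
  moreover have "ee (z - (v + 1)) = ee (z - v)"
    by (simp add: ee_diff ee_add)
  ultimately show ?thesis unfolding jac_def by (simp add: ee_add)
qed

text \<open>Replacing \<open>x\<close> by \<open>x * q\<close> moves one factor from one Pochhammer
  symbol to the other: \<open>1 - x\<close> is lost and
  \<open>1 - inverse x = - inverse x * (1 - x)\<close> is gained.\<close>

lemma jac_plus_z:
  assumes "Im z > 0"
  shows "jac (v + z) z = - ee (- z / 2 - v) * jac v z"
proof -
  define x q where "x = ee v" and "q = ee z"
  have [simp]: "x \<noteq> 0" "norm q < 1" using assms norm_ee_less_1 by (auto simp: x_def q_def)
  have 1: "ee (v + z) = x * q" "ee (z - (v + z)) = inverse x" "ee (z - v) = inverse x * q"
    by (simp_all add: x_def q_def ee_add ee_diff ee_minus field_simps)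
  have 2: "ee (- (v + z) / 2) * inverse x = ee (- v / 2) * ee (- z / 2 - v)"
    unfolding x_def ee_minus[symmetric] ee_add[symmetric] by (rule arg_cong[of _ _ ee]) (simp add: field_simps)
  have 3: "qpoch x q = (1 - x) * qpoch (x * q) q" "qpoch (inverse x) q = (1 - inverse x) * qpoch (inverse x * q) q"
    by (rule qpoch_rec; simp)+
  have 4: "1 - inverse x = - inverse x * (1 - x)" by (simp add: field_simps)
  have "jac (v + z) z = (ee (- (v + z) / 2) * inverse x) * (1 - x) * qpoch (x * q) q * qpoch (inverse x * q) q / euler_prod z ^ 2"
    unfolding jac_def 1 q_def[symmetric] by (subst 3(2), subst 4) simp
  also have "\<dots> = - ee (- z / 2 - v) * jac v z"
    unfolding 2 jac_def 1 x_def[symmetric] q_def[symmetric] 3 by simp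
  finally show ?thesis .
qed

text \<open>Inverting \<open>x\<close> swaps the two Pochhammer symbols up to their factors with
  exponent 0, whose ratio is \<open>- inverse x\<close>; the half power of \<open>x\<close> absorbs
  \<open>inverse x\<close>.\<close>

lemma jac_uminus:
  assumes "Im z > 0"
  shows "jac (- v) z = - jac v z"
proof -
  define x q where "x = ee v" and "q = ee z"
  have [simp]: "x \<noteq> 0" "norm q < 1" using assms norm_ee_less_1 by (auto simp: x_def q_def)
  have 1: "ee (- v) = inverse x" "ee (z - (- v)) = x * q" "ee (z - v) = inverse x * q"
    by (simp_all add: x_def q_def ee_add ee_diff ee_minus field_simps)
  have 2: "ee (- (- v) / 2) * inverse x = ee (- v / 2)"
    unfolding x_def ee_minus[symmetric] ee_add[symmetric] by (rule arg_cong[of _ _ ee]) (simp add: field_simps)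
  have 3: "qpoch x q = (1 - x) * qpoch (x * q) q" "qpoch (inverse x) q = (1 - inverse x) * qpoch (inverse x * q) q"
    by (rule qpoch_rec; simp)+
  have 4: "1 - inverse x = - inverse x * (1 - x)" by (simp add: field_simps)
  have "jac (- v) z = (ee (- (- v) / 2) * inverse x) * (1 - x) * qpoch (x * q) q * qpoch (inverse x * q) q / euler_prod z ^ 2"
    unfolding jac_def 1 q_def[symmetric] by (subst 3(2), subst 4) simp
  also have "\<dots> = - jac v z"
    unfolding 2 jac_def 1 x_def[symmetric] q_def[symmetric] 3 by simp
  finally show ?thesis .
qed

lemma jac_eq_0_iff:
  assumes "Im z > 0"
  shows "jac v z = 0 \<longleftrightarrow> (\<exists>m n::int. v = of_int m * z + of_int n)"
proof -
  have E: "ee w * ee z ^ k = 1 \<longleftrightarrow> (\<exists>n::int. w + of_nat k * z = of_int n)" for k w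
    by (simp add: ee_eq_1_iff[symmetric] ee_add ee_power)
  have n1: "norm (ee z) < 1" using assms by (rule norm_ee_less_1)
  have "jac v z = 0 \<longleftrightarrow> qpoch (ee v) (ee z) = 0 \<or> qpoch (ee (z - v)) (ee z) = 0"
    unfolding jac_def using euler_prod_neq_0[OF assms] by simp
  also have "\<dots> \<longleftrightarrow> (\<exists>k n. v + of_nat k * z = of_int n) \<or> (\<exists>k n. (z - v) + of_nat k * z = of_int n)"
    unfolding qpoch_eq_0_iff[OF n1] E ..
  also have "\<dots> \<longleftrightarrow> (\<exists>m n::int. v = of_int m * z + of_int n)" (is "?L \<longleftrightarrow> ?R")
  proof
    assume ?L
    then consider k n where "v + of_nat k * z = of_int n" | k n where "(z - v) + of_nat k * z = of_int n" by blast
    thus ?R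
    proof cases
      case 1
      hence "v = of_int (- int k) * z + of_int n" by (simp add: algebra_simps)
      thus ?thesis by blast
    next
      case 2
      hence "v = of_int (int k + 1) * z + of_int (- n)" by (simp add: algebra_simps)
      thus ?thesis by blast
    qed
  next
    assume ?R
    then obtain m n :: int where v: "v = of_int m * z + of_int n" by blast
    show ?L
    \<comment> \<open>Zeros with positive \<open>m\<close> come from the symbol in
      \<open>ee (z - v)\<close>, starting at \<open>m = 1\<close>; all others come from the symbol
      in \<open>ee v\<close>.\<close>
    proof (cases "m > 0")
      case True
      hence "(z - v) + of_nat (nat (m - 1)) * z = of_int (- n)" by (simp add: v algebra_simps)
      thus ?thesis by blast
    next
      case False
      hence "v + of_nat (nat (- m)) * z = of_int n" by (simp add: v algebra_simps)
      thus ?thesis by blast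
    qed
  qed
  finally show ?thesis .
qed

lemma holomorphic_jac:
  assumes "Im z > 0"
  shows "(\<lambda>v. jac v z) holomorphic_on UNIV"
  unfolding jac_def using euler_prod_neq_0[OF assms] norm_ee_less_1[OF assms]
  by (intro holomorphic_intros holomorphic_on_qpoch) auto

lemma jac_plus_int: "jac (v + of_int n) z = (-1) powi n * jac v z"
proof -
  have nat: "jac (v + of_nat n) z = (-1) ^ n * jac v z" for v n
  proof (induction n)
    case (Suc n)
    show ?case using jac_plus_1[of "v + of_nat n" z] Suc by (simp add: add_ac)
  qed simp
  show ?thesis
  proof (cases "n \<ge> 0")
    case True
    then obtain k where "n = int k" using nonneg_int_cases by blast
    thus ?thesis using nat[of v k] by simp
  next
    case False
    define k where "k = nat (- n)"
    have k: "n = - int k" using False by (simp add: k_def)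
    have "jac v z = (-1) ^ k * jac (v + of_int n) z" using nat[of "v + of_int n" k] by (simp add: k)
    thus ?thesis by (simp add: k power_int_minus)
  qed
qed

text \<open>The factors \<open>e m v\<close> form a cocycle, so iterating \<open>jac_plus_z\<close>
  multiplies them up. Negative \<open>m\<close> follows by applying the result for
  \<open>- m\<close> at the shifted point.\<close>

lemma jac_plus_int_mult_z:
  assumes "Im z > 0"
  shows "jac (v + of_int m * z) z = (-1) powi m * ee (- (of_int m ^ 2 * z / 2 + of_int m * v)) * jac v z"
proof -
  define e where "e m v = ee (- (of_int m ^ 2 * z / 2 + of_int m * v))" for m :: int and v
  have e1: "e (m + 1) v = e m v * ee (- z / 2 - (v + of_int m * z))" for m v
    unfolding e_def ee_add[symmetric] by (rule arg_cong[of _ _ ee]) (simp add: field_simps power2_eq_square)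
  have nat: "jac (v + of_nat m * z) z = (-1) ^ m * e (int m) v * jac v z" for v m
  proof (induction m)
    case 0
    show ?case by (simp add: e_def)
  next
    case (Suc m)
    have "jac (v + of_nat (Suc m) * z) z = jac ((v + of_nat m * z) + z) z"
      by (simp add: ring_distribs add_ac)
    also have "\<dots> = (-1) ^ Suc m * (e (int m) v * ee (- z / 2 - (v + of_int (int m) * z))) * jac v z"
      unfolding jac_plus_z[OF assms] Suc by simp
    finally show ?case unfolding e1[symmetric] by (simp add: add_ac)
  qed
  have e2: "e m v * e (- m) (v + of_int m * z) = 1" for m v
    unfolding e_def ee_add[symmetric] by (simp add: field_simps power2_eq_square)
  show ?thesis
  proof (cases "m \<ge> 0")
    case True
    then obtain k where "m = int k" using nonneg_int_cases by blast
    thus ?thesis using nat[of v k] by (simp add: e_def)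
  next
    case False
    define k where "k = nat (- m)"
    have k: "m = - int k" using False by (simp add: k_def)
    define J where "J = jac (v + of_int m * z) z"
    have "jac v z = (-1) ^ k * e (- m) (v + of_int m * z) * J"
      using nat[of "v + of_int m * z" k] by (simp add: k J_def)
    hence "(-1) powi m * e m v * jac v z = ((-1) powi m * (-1) ^ k) * (e m v * e (- m) (v + of_int m * z)) * J"
      by (simp add: mult_ac)
    also have "(-1::complex) powi m * (-1) ^ k = 1"
      by (simp add: k power_int_minus)
    finally show ?thesis unfolding e2 J_def by (simp add: e_def)
  qed
qed

lemma jac_shift:
  assumes "Im z > 0"
  shows "jac (v + of_int m * z + of_int n) z =
     (-1) powi (m + n) * ee (- (of_int m ^ 2 * z / 2 + of_int m * v)) * jac v z"
  unfolding jac_plus_int jac_plus_int_mult_z[OF assms] by (simp add: power_int_add)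

text \<open>Once the factor \<open>1 - ee v\<close> is split off, everything else is continuous and
  nonzero at 0, and \<open>(ee v - 1) / v\<close> tends to the derivative of \<open>ee\<close>. This
  limit later fixes the constant in the transformation law.\<close>

lemma jac_over_v_tendsto:
  assumes "Im z > 0"
  shows "((\<lambda>v. jac v z / v) \<longlongrightarrow> 2 * pi * \<i>) (at 0)"
proof -
  define q where "q = ee z"
  have n1: "norm q < 1" unfolding q_def using assms by (rule norm_ee_less_1)
  have nz: "qpoch q q \<noteq> 0" by (rule qpoch_neq_0; rule n1)
  have eq: "jac v z / v = ee (- v / 2) * ((ee v - 1) / v)
     * qpoch (ee v * q) q * qpoch (ee (- v) * q) q / qpoch q q ^ 2" for v
    unfolding jac_def q_def[symmetric] euler_prod_def
    by (subst qpoch_rec[OF n1])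
      (simp add: q_def ee_diff ee_minus divide_simps, simp add: algebra_simps)
  have "((\<lambda>v. ee v) has_field_derivative 2 * pi * \<i>) (at 0)"
    unfolding ee_def by (rule derivative_eq_intros refl)+ simp
  hence "((\<lambda>v::complex. (ee v - ee 0) / (v - 0)) \<longlongrightarrow> 2 * pi * \<i>) (at 0)"
    unfolding has_field_derivative_iff .
  hence d: "((\<lambda>v::complex. (ee v - 1) / v) \<longlongrightarrow> 2 * pi * \<i>) (at 0)" by simp
  have qc: "((\<lambda>v. qpoch (f v) q) \<longlongrightarrow> qpoch q q) (at 0)" if "(f \<longlongrightarrow> q) (at 0)" for f :: "complex \<Rightarrow> complex"
    by (rule continuous_on_tendsto_compose[OF continuous_on_qpoch[OF n1, of UNIV] that]) auto
  have "((\<lambda>v. ee (- v / 2) * ((ee v - 1) / v) * qpoch (ee v * q) q * qpoch (ee (- v) * q) q / qpoch q q ^ 2) \<longlongrightarrow>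
       ee (- 0 / 2) * (2 * pi * \<i>) * qpoch q q * qpoch q q / qpoch q q ^ 2) (at 0)"
  proof (intro tendsto_mult tendsto_divide d qc tendsto_const)
    show "((\<lambda>v. ee (- v / 2)) \<longlongrightarrow> ee (- 0 / 2)) (at 0)"
      by (intro tendsto_intros) auto
    have "((\<lambda>v. ee v * q) \<longlongrightarrow> ee 0 * q) (at 0)" "((\<lambda>v. ee (- v) * q) \<longlongrightarrow> ee (- 0) * q) (at 0)"
      by (intro tendsto_intros)+
    thus "((\<lambda>v. ee v * q) \<longlongrightarrow> q) (at 0)" "((\<lambda>v. ee (- v) * q) \<longlongrightarrow> q) (at 0)"
      by simp_all
  qed (use nz in auto)
  thus ?thesis unfolding eq using nz by (simp add: power2_eq_square)
qed

section \<open>Moebius transformations, elliptic functions and the transformation law of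
  \<open>jac\<close>\<close>

lemma minus_one_powi: "(-1::complex) powi n = (if even n then 1 else -1)"
  by (auto simp: power_int_minus_left_odd)

lemma Im_moebius_pos:
  fixes z :: complex and a b c d :: int
  assumes "Im z > 0" "a * d - b * c = 1"
  shows "of_int c * z + of_int d \<noteq> 0" "Im ((of_int a * z + of_int b) / (of_int c * z + of_int d)) > 0"
proof -
  have nz: "of_int c * z + of_int d \<noteq> 0"
  proof
    assume 0: "of_int c * z + of_int d = 0"
    have "of_int c * Im z = 0" using arg_cong[OF 0, of Im] by simp
    hence "c = 0" using assms(1) by simp
    moreover from this have "d = 0" using 0 by simp
    ultimately show False using assms(2) by simp
  qed
  define w where "w = of_int c * z + of_int d"
  have "Im ((of_int a * z + of_int b) * cnj w) = of_int (a * d - b * c) * Im z"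
    by (simp add: w_def algebra_simps)
  hence "Im ((of_int a * z + of_int b) / w) = Im z / (cmod w)\<^sup>2"
    using assms(2) by (simp add: complex_div_cnj[of _ w] power2_eq_square[symmetric] flip: of_real_power)
  thus "Im ((of_int a * z + of_int b) / (of_int c * z + of_int d)) > 0"
    using nz assms(1) by (simp add: w_def)
  show "of_int c * z + of_int d \<noteq> 0" by (rule nz)
qed

lemma periodic_int:
  fixes f :: "complex \<Rightarrow> 'a"
  assumes "\<And>v. f (v + w) = f v"
  shows "f (v + of_int n * w) = f v"
proof -
  have nat: "f (v + of_nat n * w) = f v" for v n
  proof (induction n)
    case (Suc n)
    thus ?case using assms[of "v + of_nat n * w"] by (simp add: algebra_simps)
  qed simp
  show ?thesis
  proof (cases "n \<ge> 0")
    case True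
    thus ?thesis using nat[of v "nat n"] by simp
  next
    case False
    thus ?thesis using nat[of "v + of_int n * w" "nat (- n)"] by simp
  qed
qed

text \<open>All values are taken on the closed period parallelogram, which is compact; hence the
  function is bounded and Liouville applies.\<close>

lemma entire_elliptic_imp_constant:
  assumes holo: "f holomorphic_on UNIV" and z: "Im z > 0"
    and per: "\<And>v. f (v + 1) = f v" "\<And>v. f (v + z) = f v"
  shows "f v = f w"
proof -
  define K where "K = (\<lambda>(r, s). of_real r + of_real s * z) ` ({0..1} \<times> {0..1::real})"
  have "compact K" unfolding K_def split_def
    by (intro compact_continuous_image compact_Times continuous_intros) auto
  hence "bounded (f ` K)"
    using holo by (intro compact_imp_bounded compact_continuous_image)
      (auto intro: holomorphic_on_imp_continuous_on holomorphic_on_subset)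
  moreover have "range f \<subseteq> f ` K"
  proof safe
    fix v
    define s r where "s = Im v / Im z" and "r = Re v - s * Re z"
    have v: "v = of_real r + of_real s * z"
      using z by (simp add: complex_eq_iff r_def s_def)
    define v' where "v' = of_real (frac r) + of_real (frac s) * z"
    have "v = v' + of_int \<lfloor>s\<rfloor> * z + of_int \<lfloor>r\<rfloor> * 1"
      unfolding v v'_def frac_def by (simp add: algebra_simps)
    hence "f v = f v'" using periodic_int[of f 1] periodic_int[of f z] per by metis
    moreover have "v' \<in> K" unfolding K_def v'_def
      by (rule image_eqI[of _ _ "(frac r, frac s)"]) (auto simp: less_imp_le[OF frac_lt_1])
    ultimately show "f v \<in> f ` K" by blast
  qed
  ultimately have "bounded (range f)" using bounded_subset by blast
  from Liouville_theorem[OF holo this] show ?thesis by (auto simp: constant_on_def)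
qed

text \<open>Both sides, divided by each other, give an elliptic function of \<open>v\<close> without zeros and poles.\<close>
theorem jac_modular:
  fixes z v :: complex and a b c d :: int
  assumes z: "Im z > 0" and det: "a * d - b * c = 1"
  defines "j \<equiv> of_int c * z + of_int d" and "\<tau> \<equiv> (of_int a * z + of_int b) / (of_int c * z + of_int d)"
  shows "jac (v / j) \<tau> = inverse j * ee (of_int c * v ^ 2 / (2 * j)) * jac v z"
proof -
  have j0: "j \<noteq> 0" and \<tau>: "Im \<tau> > 0"
    using Im_moebius_pos[OF z det] by (auto simp: j_def \<tau>_def)
  have j\<tau>: "j * \<tau> = of_int a * z + of_int b" using j0 by (simp add: \<tau>_def j_def)
  have det': "of_int a * of_int d - of_int b * of_int c = (1::complex)"
    using det by (metis of_int_1 of_int_diff of_int_mult)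
  \<comment> \<open>The periods 1 and \<open>z\<close> are written in the lattice
    \<open>j * (\<int> + \<int> * \<tau>)\<close>, by inverting the matrix. Shifts of
    \<open>v\<close> by a period then become lattice shifts of \<open>v / j\<close>.\<close>
  have inv1: "1 = j * (of_int a - of_int c * \<tau>)"
  proof -
    have "j * (of_int a - of_int c * \<tau>) = of_int a * j - of_int c * (j * \<tau>)" by (simp add: algebra_simps)
    also have "\<dots> = of_int a * of_int d - of_int b * of_int c"
      unfolding j\<tau> by (simp add: j_def algebra_simps)
    finally show ?thesis using det' by simp
  qed
  have invz: "z = j * (of_int d * \<tau> - of_int b)"
  proof -
    have "j * (of_int d * \<tau> - of_int b) = of_int d * (j * \<tau>) - of_int b * j" by (simp add: algebra_simps)
    also have "\<dots> = (of_int a * of_int d - of_int b * of_int c) * z"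
      unfolding j\<tau> by (simp add: j_def algebra_simps)
    finally show ?thesis using det' by simp
  qed
  \<comment> \<open>An odd determinant forbids a column with two even entries. This parity makes
    both sign factors of the quasi-periods below equal to -1.\<close>
  have odd1: "odd (a + c + a * c)" and odd2: "odd (b + d + b * d)"
  proof -
    have "odd (a * d - b * c)" using det by simp
    thus "odd (a + c + a * c)" "odd (b + d + b * d)" by auto
  qed
  \<comment> \<open>With the automorphy and Gaussian factors moved to the left side, the claim
    becomes \<open>\<psi> v = jac v z\<close>.\<close>
  define \<psi> where "\<psi> v = j * ee (- (of_int c * v ^ 2 / (2 * j))) * jac (v / j) \<tau>" for v
  have \<psi>1: "\<psi> (v + 1) = - \<psi> v" for v
  proof -
    define w where "w = v / j"
    have v: "v = j * w" using j0 by (simp add: w_def)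
    have "(v + 1) / j = w + of_int (- c) * \<tau> + of_int a"
      using j0 arg_cong[OF inv1, of "\<lambda>x. x / j"] by (simp add: w_def add_divide_distrib)
    hence "jac ((v + 1) / j) \<tau> = (-1) powi (- c + a) * ee (- (of_int c ^ 2 * \<tau> / 2 - of_int c * w)) * jac w \<tau>"
      using jac_shift[OF \<tau>, of w "- c" a] by simp
    moreover have "ee (- (of_int c * (v + 1) ^ 2 / (2 * j))) * ee (- (of_int c ^ 2 * \<tau> / 2 - of_int c * w))
      = ee (- (of_int c * v ^ 2 / (2 * j))) * ee (- (of_int (a * c) / 2))"
    proof -
      have "of_int c * (v + 1) ^ 2 / (2 * j) = of_int c * v ^ 2 / (2 * j) + of_int c * w + of_int c / 2 * (1 / j)"
        using j0 by (simp add: v power2_eq_square field_simps)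
      also have "1 / j = of_int a - of_int c * \<tau>" using j0 inv1 by (simp add: field_simps)
      finally show ?thesis
        unfolding ee_add[symmetric]
        by (intro arg_cong[of _ _ ee], simp only:)
          (simp add: algebra_simps power2_eq_square diff_divide_distrib add_divide_distrib)
    qed
    ultimately have "\<psi> (v + 1) = ((-1) powi (- c + a) * ee (- (of_int (a * c) / 2))) * \<psi> v"
      unfolding \<psi>_def w_def by (simp add: mult_ac)
    also have "(-1) powi (- c + a) * ee (- (of_int (a * c) / 2)) = (-1::complex)"
      using ee_half_int[of "- (a * c)"] odd1 by (auto simp: minus_one_powi split: if_splits)
    finally show ?thesis by simp
  qed
  have \<psi>z: "\<psi> (v + z) = - ee (- z / 2 - v) * \<psi> v" for v
  proof -
    define w where "w = v / j"
    have v: "v = j * w" using j0 by (simp add: w_def)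
    have zj: "z / j = of_int d * \<tau> - of_int b" using j0 invz by (simp add: field_simps)
    have "(v + z) / j = w + of_int d * \<tau> + of_int (- b)"
      by (simp add: w_def add_divide_distrib zj)
    hence "jac ((v + z) / j) \<tau> = (-1) powi (d + - b) * ee (- (of_int d ^ 2 * \<tau> / 2 + of_int d * w)) * jac w \<tau>"
      using jac_shift[OF \<tau>, of w d "- b"] by simp
    moreover have "ee (- (of_int c * (v + z) ^ 2 / (2 * j))) * ee (- (of_int d ^ 2 * \<tau> / 2 + of_int d * w))
      = ee (- (of_int c * v ^ 2 / (2 * j))) * (ee (- z / 2 - v) * ee (- (of_int (b * d) / 2)))"
    proof -
      have "of_int c * (v + z) ^ 2 / (2 * j) = of_int c * v ^ 2 / (2 * j) + of_int c * z * w + of_int c * z / 2 * (z / j)"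
        using j0 by (simp add: v power2_eq_square field_simps)
      also have "\<dots> = of_int c * v ^ 2 / (2 * j) + (v - of_int d * w) + (of_int c * z * of_int d * \<tau> - of_int b * of_int c * z) / 2"
        unfolding zj v by (simp add: j_def algebra_simps diff_divide_distrib)
      also have "of_int c * z * of_int d * \<tau> = of_int d * (j * \<tau>) - of_int d ^ 2 * \<tau>"
        by (simp add: j_def algebra_simps power2_eq_square)
      also have "of_int d * (j * \<tau>) - of_int d ^ 2 * \<tau> - of_int b * of_int c * z =
         (of_int a * of_int d - of_int b * of_int c) * z + of_int b * of_int d - of_int d ^ 2 * \<tau>"
        unfolding j\<tau> by (simp add: algebra_simps)
      also have "\<dots> = z + of_int b * of_int d - of_int d ^ 2 * \<tau>" unfolding det' by simp
      finally show ?thesis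
        unfolding ee_add[symmetric]
        by (intro arg_cong[of _ _ ee], simp only:)
          (simp add: algebra_simps power2_eq_square diff_divide_distrib add_divide_distrib)
    qed
    ultimately have "\<psi> (v + z) = ((-1) powi (d + - b) * ee (- (of_int (b * d) / 2))) * ee (- z / 2 - v) * \<psi> v"
      unfolding \<psi>_def w_def by (simp add: mult_ac)
    also have "(-1) powi (d + - b) * ee (- (of_int (b * d) / 2)) = (-1::complex)"
      using ee_half_int[of "- (b * d)"] odd2 by (auto simp: minus_one_powi split: if_splits)
    finally show ?thesis by simp
  qed
  define U where "U = {v. jac v z \<noteq> 0}"
  \<comment> \<open>The value 1 at the zeros is the limit of the quotient there: at 0 both functions
    behave like \<open>2 * pi * \<i> * v\<close>, and periodicity carries this to the other lattice
    points.\<close>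
  define h where "h v = (if jac v z = 0 then 1 else \<psi> v / jac v z)" for v
  have contj: "continuous_on UNIV (\<lambda>v. jac v z)"
    by (rule holomorphic_on_imp_continuous_on[OF holomorphic_jac[OF z]])
  have openU: "open U"
    unfolding U_def by (intro open_Collect_neq contj continuous_intros)
  have holo\<psi>: "\<psi> holomorphic_on UNIV"
  proof -
    have "((\<lambda>v. jac v \<tau>) \<circ> (\<lambda>v. v / j)) holomorphic_on UNIV"
      using j0 by (intro holomorphic_on_compose holomorphic_intros holomorphic_on_subset[OF holomorphic_jac[OF \<tau>]]) auto
    thus ?thesis unfolding \<psi>_def o_def using j0 by (intro holomorphic_intros) auto
  qed
  have holoU: "h holomorphic_on U"
  proof -
    have "(\<lambda>v. \<psi> v / jac v z) holomorphic_on U"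
      by (intro holomorphic_intros holomorphic_on_subset[OF holo\<psi>] holomorphic_on_subset[OF holomorphic_jac[OF z]])
        (auto simp: U_def)
    thus ?thesis by (rule holomorphic_transform) (auto simp: U_def h_def)
  qed
  have h1: "h (v + 1) = h v" for v by (simp add: h_def jac_plus_1 \<psi>1)
  have hz: "h (v + z) = h v" for v by (simp add: h_def jac_plus_z[OF z] \<psi>z)
  have \<psi>0: "((\<lambda>v. \<psi> v / v) \<longlongrightarrow> 2 * pi * \<i>) (at 0)"
  proof -
    have f: "filterlim (\<lambda>v. v / j) (at 0) (at 0)"
      using j0 by (intro filterlim_atI) (auto intro!: tendsto_eq_intros eventually_neq_at_within)
    have "((\<lambda>v. ee (- (of_int c * v ^ 2 / (2 * j))) * (jac (v / j) \<tau> / (v / j))) \<longlongrightarrow>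
        ee (- (of_int c * 0 ^ 2 / (2 * j))) * (2 * pi * \<i>)) (at 0)"
      using j0 by (intro tendsto_mult filterlim_compose[OF jac_over_v_tendsto[OF \<tau>] f] tendsto_intros) auto
    thus ?thesis by (simp add: \<psi>_def mult_ac)
  qed
  have evU: "eventually (\<lambda>v. v \<in> U) (at 0)"
  proof -
    have "eventually (\<lambda>v. jac v z / v \<noteq> 0) (at 0)"
      by (rule tendsto_imp_eventually_ne[OF jac_over_v_tendsto[OF z]]) auto
    thus ?thesis by eventually_elim (auto simp: U_def)
  qed
  have jac0: "jac 0 z = 0" using jac_eq_0_iff[OF z, of 0] by (metis add_0 mult_zero_left of_int_0)
  have h0: "(h \<longlongrightarrow> h 0) (at 0)"
  proof -
    have "((\<lambda>v. (\<psi> v / v) / (jac v z / v)) \<longlongrightarrow> (2 * pi * \<i>) / (2 * pi * \<i>)) (at 0)"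
      by (intro tendsto_divide \<psi>0 jac_over_v_tendsto[OF z]) auto
    moreover have "eventually (\<lambda>v. (\<psi> v / v) / (jac v z / v) = h v) (at 0)"
      using evU eventually_neq_at_within[of 0] by eventually_elim (auto simp: h_def U_def)
    ultimately have "(h \<longlongrightarrow> (2 * pi * \<i>) / (2 * pi * \<i>)) (at 0)"
      using tendsto_cong by fast
    thus ?thesis by (simp add: h_def jac0)
  qed
  obtain e where e: "e > 0" "\<And>x. x \<noteq> 0 \<Longrightarrow> dist x 0 < e \<Longrightarrow> x \<in> U"
    using evU unfolding eventually_at by auto
  have holo0: "h holomorphic_on ball 0 e"
  proof (rule no_isolated_singularity'[where K = "{0}"])
    show "(h \<longlongrightarrow> h w) (at w within ball 0 e)" if "w \<in> {0}" for w
      using that tendsto_within_subset[OF h0, of "ball 0 e"] by simp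
    show "h holomorphic_on ball 0 e - {0}"
      using e(2) by (intro holomorphic_on_subset[OF holoU]) (force simp: dist_commute)
  qed auto
  \<comment> \<open>Off the lattice \<open>h\<close> is a quotient with nonzero denominator. At a
    lattice point a translation reduces to the removable singularity at 0.\<close>
  have holo: "h holomorphic_on UNIV"
    unfolding holomorphic_on_def
  proof safe
    fix v
    show "h field_differentiable at v within UNIV"
    proof (cases "v \<in> U")
      case True
      thus ?thesis using holoU openU by (simp add: holomorphic_on_imp_differentiable_at)
    next
      case False
      then obtain m n :: int where v: "v = of_int m * z + of_int n"
        using jac_eq_0_iff[OF z] by (auto simp: U_def)
      have hper: "h u = h (u - v)" for u
        using periodic_int[of h 1 "(u - v) + of_int m * z" n] periodic_int[of h z "u - v" m] h1 hz
        by (simp add: v)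
      have "h field_differentiable at (v - v)"
        using holo0 e by (simp add: holomorphic_on_imp_differentiable_at)
      hence "(h \<circ> (\<lambda>u. u - v)) field_differentiable at v"
        by (intro field_differentiable_compose) (auto intro!: derivative_intros)
      thus ?thesis using hper by (simp add: o_def)
    qed
  qed
  have hc: "h v = 1" for v
    using entire_elliptic_imp_constant[OF holo z h1 hz, of v 0] by (simp add: h_def jac0)
  have \<psi>jac: "\<psi> v = jac v z" for v
  proof (cases "jac v z = 0")
    case False
    thus ?thesis using hc[of v] by (simp add: h_def)
  next
    \<comment> \<open>At a zero of \<open>jac\<close> the equation \<open>h v = 1\<close> carries no
      information, so \<open>\<psi> v = 0\<close> is shown directly: \<open>v / j\<close> lies in
      the lattice of \<open>\<tau>\<close>.\<close>
    case True
    then obtain m n :: int where v: "v = of_int m * z + of_int n"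
      using jac_eq_0_iff[OF z] by auto
    have "v = of_int m * (j * (of_int d * \<tau> - of_int b)) + of_int n * (j * (of_int a - of_int c * \<tau>))"
      using v by (simp only: invz[symmetric] inv1[symmetric] mult_1_right)
    hence "v / j = of_int (m * d - n * c) * \<tau> + of_int (n * a - m * b)"
      using j0 by (simp add: field_simps)
    hence "jac (v / j) \<tau> = 0" using jac_eq_0_iff[OF \<tau>] by blast
    thus ?thesis using True by (simp add: \<psi>_def)
  qed
  have "inverse j * ee (of_int c * v ^ 2 / (2 * j)) * \<psi> v = jac (v / j) \<tau>"
  proof -
    have "inverse x * y * (x * inverse y * t) = t" if "x \<noteq> 0" "y \<noteq> 0" for x y t :: complex
      using that by (simp add: field_simps)
    thus ?thesis using j0 by (simp add: \<psi>_def ee_minus)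
  qed
  thus ?thesis unfolding \<psi>jac by simp
qed

section \<open>Product identities for q-Pochhammer symbols\<close>

lemma qpoch_mult_uminus:
  assumes "norm q < 1"
  shows "qpoch x q * qpoch (- x) q = qpoch (x ^ 2) (q ^ 2)"
proof -
  have "qpoch x q * qpoch (- x) q = (\<Prod>k. (1 - x * q ^ k) * (1 - (- x) * q ^ k))"
    unfolding qpoch_def by (intro prodinf_mult convergent_prod_qpoch assms)
  also have "(\<lambda>k. (1 - x * q ^ k) * (1 - (- x) * q ^ k)) = (\<lambda>k. 1 - x ^ 2 * (q ^ 2) ^ k)"
    by (rule ext) (simp add: power2_eq_square power_mult_distrib algebra_simps)
  finally show ?thesis by (simp add: qpoch_def)
qed

lemma qpoch_even_odd:
  assumes "norm q < 1"
  shows "qpoch x q = qpoch x (q ^ 2) * qpoch (x * q) (q ^ 2)"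
proof (rule LIMSEQ_unique)
  have q2: "norm (q ^ 2) < 1"
    using assms by (simp add: norm_power power_less_one_iff)
  show "(\<lambda>N. \<Prod>k<2 * N. 1 - x * q ^ k) \<longlonglongrightarrow> qpoch x q"
    using LIMSEQ_subseq_LIMSEQ[OF qpoch_LIMSEQ[OF assms], of "\<lambda>N. 2 * N"]
    by (simp add: o_def strict_mono_def)
  have "(\<Prod>k<2 * N. 1 - x * q ^ k) = (\<Prod>k<N. 1 - x * (q ^ 2) ^ k) * (\<Prod>k<N. 1 - (x * q) * (q ^ 2) ^ k)" for N
    by (induction N) (simp_all add: power_mult[symmetric] mult_ac)
  thus "(\<lambda>N. \<Prod>k<2 * N. 1 - x * q ^ k) \<longlonglongrightarrow> qpoch x (q ^ 2) * qpoch (x * q) (q ^ 2)"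
    using tendsto_mult[OF qpoch_LIMSEQ[OF q2, of x] qpoch_LIMSEQ[OF q2, of "x * q"]] by simp
qed

text \<open>Both sides are polynomials in \<open>y\<close> of degree at most \<open>p\<close> and
  agree at \<open>p + 1\<close> points, namely 0 and the \<open>p\<close>-th roots of unity.\<close>

lemma prod_one_minus_roots_of_unity:
  assumes "p > 0"
  shows "(\<Prod>l<p. 1 - ee (of_nat l / of_nat p) * y) = 1 - y ^ p"
proof -
  define f where "f = (\<Prod>l<p. [:1, - ee (of_nat l / of_nat p):])"
  define g :: "complex poly" where "g = 1 - monom 1 p"
  define R where "R = {x::complex. x ^ p = 1}"
  have cardR: "card R = p" "finite R" unfolding R_def
    using card_roots_unity_eq[of p] finite_roots_unity[of p] assms by auto
  have "f = g"
  proof (rule poly_eqI_degree[of "insert 0 R"])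
    have "0 \<notin> R" using assms by (simp add: R_def power_0_left)
    hence card: "card (insert 0 R) = Suc p" using cardR by simp
    have "degree f \<le> (\<Sum>l<p. degree [:1, - ee (of_nat l / of_nat p):])"
      unfolding f_def using degree_prod_sum_le[of "{..<p}" "\<lambda>l. [:1, - ee (of_nat l / of_nat p):]"]
      by (simp add: o_def)
    also have "\<dots> \<le> p" using sum_mono[of "{..<p}" "\<lambda>l. degree [:1, - ee (of_nat l / of_nat p):]" "\<lambda>_. 1"] by simp
    finally show "degree f < card (insert 0 R)" using card by simp
    have "degree g \<le> p" unfolding g_def by (rule degree_diff_le) (auto simp: degree_monom_le)
    thus "degree g < card (insert 0 R)" using card by simp
    fix x assume "x \<in> insert 0 R"
    thus "poly f x = poly g x"
    proof
      assume "x = 0"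
      thus ?thesis using assms by (simp add: f_def g_def poly_prod poly_monom)
    next
      assume x: "x \<in> R"
      then obtain k where k: "k < p" "x = ee (of_nat k / of_nat p)"
        using complex_roots_unity[of p] assms by (auto simp: R_def ee_def mult_ac)
      define l where "l = (if k = 0 then 0 else p - k)"
      have "l < p" using k assms by (auto simp: l_def)
      moreover have "ee (of_nat l / of_nat p) * x = 1"
      proof (cases "k = 0")
        case False
        hence "of_nat l / of_nat p + of_nat k / of_nat p = (1::complex)"
          using k assms by (simp add: l_def of_nat_diff add_divide_distrib[symmetric])
        thus ?thesis unfolding k(2) ee_add[symmetric] by simp
      qed (simp add: l_def k)
      ultimately have "poly f x = 0" unfolding f_def poly_prod
        by (intro prod_zero) (auto intro!: bexI[of _ l] simp: mult_ac)
      thus ?thesis using x by (simp add: g_def poly_monom R_def)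
    qed
  qed
  hence "poly f y = poly g y" by simp
  thus ?thesis by (simp add: f_def g_def poly_prod poly_monom mult_ac)
qed

lemma prod_qpoch_roots_of_unity:
  assumes "p > 0" "norm q < 1"
  shows "(\<Prod>l<p. qpoch (ee (of_nat l / of_nat p) * x) q) = qpoch (x ^ p) (q ^ p)"
proof -
  have "(\<Prod>l<p. qpoch (ee (of_nat l / of_nat p) * x) q) =
      (\<Prod>k. \<Prod>l<p. 1 - (ee (of_nat l / of_nat p) * x) * q ^ k)"
    unfolding qpoch_def by (rule prodinf_prod[symmetric]) (rule convergent_prod_qpoch[OF assms(2)])
  also have "(\<lambda>k. \<Prod>l<p. 1 - (ee (of_nat l / of_nat p) * x) * q ^ k) = (\<lambda>k. 1 - x ^ p * (q ^ p) ^ k)"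
    using prod_one_minus_roots_of_unity[OF assms(1), of "x * q ^ k" for k]
    by (simp add: mult.assoc power_mult_distrib power_mult[symmetric] mult.commute[of p])
  finally show ?thesis by (simp add: qpoch_def)
qed

section \<open>Klein forms and the discriminant\<close>

text \<open>A Klein form with characteristic \<open>(r, s)\<close>. The exponential prefactor
  absorbs the Gaussian factor of \<open>jac_modular\<close>, so that a matrix acts by right
  multiplication on \<open>(r, s)\<close>.\<close>

definition klein :: "complex \<Rightarrow> complex \<Rightarrow> complex \<Rightarrow> complex" where
  "klein r s z = ee (r * (r * z + s) / 2) * jac (r * z + s) z"

text \<open>With \<open>w = r' * z + s'\<close> one has \<open>r' * j = r + of_int c * w\<close>;
  this is exactly what merges the prefactor at \<open>\<tau>\<close> and the Gaussian factor into
  the prefactor at \<open>z\<close>.\<close>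

lemma klein_modular:
  fixes z r s :: complex and a b c d :: int
  assumes z: "Im z > 0" and det: "a * d - b * c = 1"
  defines "j \<equiv> of_int c * z + of_int d" and "\<tau> \<equiv> (of_int a * z + of_int b) / (of_int c * z + of_int d)"
  shows "klein r s \<tau> = inverse j * klein (r * of_int a + s * of_int c) (r * of_int b + s * of_int d) z"
proof -
  have j0: "j \<noteq> 0" using Im_moebius_pos[OF z det] by (auto simp: j_def)
  define r' s' where "r' = r * of_int a + s * of_int c" and "s' = r * of_int b + s * of_int d"
  define w where "w = r' * z + s'"
  have det': "of_int a * of_int d - of_int b * of_int c = (1::complex)"
    using det by (metis of_int_1 of_int_diff of_int_mult)
  have w: "r * \<tau> + s = w / j"
  proof -
    have "(r * \<tau> + s) * j = r * (j * \<tau>) + s * j" by (simp add: algebra_simps)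
    also have "j * \<tau> = of_int a * z + of_int b" using j0 by (simp add: j_def \<tau>_def)
    also have "r * (of_int a * z + of_int b) + s * j = w"
      by (simp add: w_def r'_def s'_def j_def algebra_simps)
    finally show ?thesis using j0 by (simp add: field_simps)
  qed
  have "r' * j = r * (of_int a * of_int d - of_int b * of_int c) + of_int c * w"
    by (simp add: w_def j_def r'_def s'_def algebra_simps)
  hence rj: "r' * j = r + of_int c * w" by (simp add: det')
  have "r * (w / j) / 2 + of_int c * w ^ 2 / (2 * j) = w * (r + of_int c * w) / (2 * j)"
    using j0 by (simp add: field_simps power2_eq_square)
  also have "\<dots> = r' * w / 2" unfolding rj[symmetric] using j0 by simp
  finally have e: "r * (w / j) / 2 + of_int c * w ^ 2 / (2 * j) = r' * w / 2" .
  have "klein r s \<tau> = ee (r * (w / j) / 2) * (inverse j * ee (of_int c * w ^ 2 / (2 * j)) * jac w z)"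
    unfolding klein_def w using jac_modular[OF z det, of w] by (simp add: j_def \<tau>_def)
  also have "\<dots> = inverse j * ee (r * (w / j) / 2 + of_int c * w ^ 2 / (2 * j)) * jac w z"
    by (simp add: ee_add mult_ac)
  also have "\<dots> = inverse j * ee (r' * w / 2) * jac w z" unfolding e ..
  finally show ?thesis unfolding klein_def r'_def[symmetric] s'_def[symmetric] w_def by (simp add: mult_ac)
qed

text \<open>The terms of the exponent that involve \<open>z\<close> cancel, so for rational
  \<open>r\<close> and \<open>s\<close> an integral shift costs only a root of unity.\<close>

lemma klein_shift:
  assumes "Im z > 0"
  shows "klein (r + of_int m) (s + of_int n) z =
    (-1) powi (m + n) * ee ((r * of_int n - s * of_int m + of_int (m * n)) / 2) * klein r s z"
proof -
  define v where "v = r * z + s"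
  have "(r + of_int m) * z + (s + of_int n) = v + of_int m * z + of_int n"
    by (simp add: v_def algebra_simps)
  hence "klein (r + of_int m) (s + of_int n) z = (-1) powi (m + n) *
    (ee ((r + of_int m) * (v + of_int m * z + of_int n) / 2) * ee (- (of_int m ^ 2 * z / 2 + of_int m * v))) * jac v z"
    unfolding klein_def by (simp only: jac_shift[OF assms]) simp
  also have "ee ((r + of_int m) * (v + of_int m * z + of_int n) / 2) * ee (- (of_int m ^ 2 * z / 2 + of_int m * v))
    = ee ((r * of_int n - s * of_int m + of_int (m * n)) / 2) * ee (r * v / 2)"
    unfolding ee_add[symmetric] by (rule arg_cong[of _ _ ee]) (simp add: v_def field_simps power2_eq_square)
  finally show ?thesis by (simp add: klein_def v_def)
qed

lemma klein_0: "klein 0 s z = jac s z"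
  by (simp add: klein_def)

definition delta :: "complex \<Rightarrow> complex" where
  "delta z = ee z * euler_prod z ^ 24"

text \<open>Euler's identity \<open>(-q; q) (q; q^2) = 1\<close>, with \<open>(q; q^2)\<close> split
  over the two square roots of \<open>q\<close>. It follows by comparing two factorisations of
  \<open>(q; q)\<close> and \<open>(q^2; q^2)\<close>.\<close>

lemma euler_identity:
  assumes "Im z > 0"
  shows "qpoch (- ee z) (ee z) * qpoch (ee (z / 2)) (ee z) * qpoch (- ee (z / 2)) (ee z) = 1"
proof -
  define q where "q = ee z"
  have q: "norm q < 1" using norm_ee_less_1[OF assms] by (simp add: q_def)
  have q2: "norm (q ^ 2) < 1"
    using q by (simp add: norm_power power_less_one_iff)
  have "ee (z / 2) ^ 2 = q" by (simp add: ee_power q_def)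
  hence 1: "qpoch (ee (z / 2)) q * qpoch (- ee (z / 2)) q = qpoch q (q ^ 2)"
    using qpoch_mult_uminus[OF q, of "ee (z / 2)"] by simp
  have 2: "qpoch q q * qpoch (- q) q = qpoch (q ^ 2) (q ^ 2)"
    using qpoch_mult_uminus[OF q] .
  have 3: "qpoch q q = qpoch q (q ^ 2) * qpoch (q ^ 2) (q ^ 2)"
    using qpoch_even_odd[OF q, of q] by (simp add: power2_eq_square)
  have nz: "qpoch q q \<noteq> 0" using qpoch_neq_0[OF q q] .
  have "qpoch q q * (qpoch (- q) q * qpoch q (q ^ 2)) = qpoch q q"
    using 2 3 by (simp add: mult_ac)
  hence "qpoch (- q) q * qpoch q (q ^ 2) = 1" using nz by simp
  thus ?thesis using 1 by (simp add: q_def mult_ac)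
qed

text \<open>The Pochhammer symbols at the three nonzero 2-torsion points multiply to the square of
  Euler's identity. What is left is a constant times \<open>q^(-1/4)\<close> and
  \<open>E ^ 6\<close> in the denominator, whose fourth power cancels \<open>delta\<close>.\<close>

lemma klein_half_prod:
  assumes "Im z > 0"
  shows "(klein 0 (1/2) z * klein (1/2) 0 z * klein (1/2) (1/2) z) ^ 4 * delta z = - 16"
proof -
  define q h E where "q = ee z" and "h = ee (z / 2)" and "E = euler_prod z"
  have q: "norm q < 1" using norm_ee_less_1[OF assms] by (simp add: q_def)
  have E0: "E \<noteq> 0" using euler_prod_neq_0[OF assms] by (simp add: E_def)
  have "jac (1/2) z = - ee (- (1/4)) * qpoch (- 1) q * qpoch (- q) q / E ^ 2"
    using ee_diff[of z "1/2"] by (simp add: jac_def q_def E_def ee_half)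
  also have "qpoch (- 1) q = 2 * qpoch (- q) q" using qpoch_rec[OF q, of "-1"] by simp
  finally have 1: "klein 0 (1/2) z = - 2 * ee (- (1/4)) * qpoch (- q) q ^ 2 / E ^ 2"
    by (simp add: klein_0 power2_eq_square)
  have "klein (1/2) 0 z = - (ee (z / 8) * ee (- (z / 4))) * qpoch h q ^ 2 / E ^ 2"
    by (simp add: klein_def jac_def q_def E_def h_def power2_eq_square)
  also have "ee (z / 8) * ee (- (z / 4)) = ee (- z / 8)"
    unfolding ee_add[symmetric] by (rule arg_cong[of _ _ ee]) (simp add: field_simps)
  finally have 2: "klein (1/2) 0 z = - ee (- z / 8) * qpoch h q ^ 2 / E ^ 2" .
  have m: "ee (z / 2 + 1 / 2) = - h" "ee (z - (z / 2 + 1 / 2)) = - h"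
    using ee_add[of "z / 2" "1 / 2"] ee_diff[of "z / 2" "1 / 2"]
    by (simp_all add: ee_half h_def field_simps)
  have "klein (1/2) (1/2) z = - (ee ((z / 2 + 1 / 2) / 4) * ee (- (z / 2 + 1 / 2) / 2)) * qpoch (- h) q ^ 2 / E ^ 2"
    by (simp add: klein_def jac_def q_def E_def m[simplified] power2_eq_square)
  also have "ee ((z / 2 + 1 / 2) / 4) * ee (- (z / 2 + 1 / 2) / 2) = ee (- (z + 1) / 8)"
    unfolding ee_add[symmetric] by (rule arg_cong[of _ _ ee]) (simp add: field_simps)
  finally have 3: "klein (1/2) (1/2) z = - ee (- (z + 1) / 8) * qpoch (- h) q ^ 2 / E ^ 2" .
  define W where "W = qpoch (- q) q * qpoch h q * qpoch (- h) q"
  have W: "W = 1" using euler_identity[OF assms] by (simp add: W_def q_def h_def)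
  have "klein 0 (1/2) z * klein (1/2) 0 z * klein (1/2) (1/2) z =
     - 2 * (ee (- (1/4)) * ee (- z / 8) * ee (- (z + 1) / 8)) * W ^ 2 / E ^ 6"
    unfolding 1 2 3 W_def by (simp add: power_mult_distrib field_simps power_add[symmetric] flip: power_mult)
  also have "ee (- (1/4)) * ee (- z / 8) * ee (- (z + 1) / 8) = ee (- z / 4 - 3 / 8)"
    unfolding ee_add[symmetric] by (rule arg_cong[of _ _ ee]) (simp add: field_simps)
  finally have "(klein 0 (1/2) z * klein (1/2) 0 z * klein (1/2) (1/2) z) ^ 4 =
     16 * ee (- z / 4 - 3 / 8) ^ 4 / E ^ 24"
    by (simp add: W power_mult_distrib power_divide flip: power_mult)
  also have "ee (- z / 4 - 3 / 8) ^ 4 = - inverse (ee z)"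
  proof -
    have "of_nat 4 * (- z / 4 - 3 / 8) = - z + of_int (-3) / 2" by simp
    hence "ee (- z / 4 - 3 / 8) ^ 4 = ee (- z) * ee (of_int (-3) / 2)"
      unfolding ee_power ee_add[symmetric] by simp
    also have "ee (of_int (-3) / 2) = -1" unfolding ee_half_int minus_one_powi by simp
    finally show ?thesis by (simp add: ee_minus)
  qed
  finally show ?thesis using E0 by (simp add: delta_def E_def[symmetric] field_simps)
qed

text \<open>A matrix permutes the three nonzero 2-torsion points, so the product in
  \<open>klein_half_prod\<close> is preserved up to weight: three Klein forms of weight -1, each to
  the fourth power, give weight -12, and \<open>delta\<close> must compensate.\<close>

lemma delta_modular:
  fixes z :: complex and a b c d :: int
  assumes z: "Im z > 0" and det: "a * d - b * c = 1"
  shows "delta ((of_int a * z + of_int b) / (of_int c * z + of_int d)) = (of_int c * z + of_int d) ^ 12 * delta z"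
proof -
  define j where "j = of_int c * z + of_int d"
  define \<tau> where "\<tau> = (of_int a * z + of_int b) / j"
  have j0: "j \<noteq> 0" and \<tau>: "Im \<tau> > 0"
    using Im_moebius_pos[OF z det] by (auto simp: j_def \<tau>_def)
  \<comment> \<open>The fourth power kills the roots of unity from \<open>klein_shift\<close> at
    half-integral characteristics, so \<open>\<kappa>\<close> depends only on the parities of its
    arguments.\<close>
  define \<kappa> where "\<kappa> x y = klein (of_int x / 2) (of_int y / 2) z ^ 4" for x y :: int
  have \<kappa>: "\<kappa> (x + 2 * m) (y + 2 * n) = \<kappa> x y" for x y m n
  proof -
    have "klein (of_int x / 2 + of_int m) (of_int y / 2 + of_int n) z ^ 4 =
       ((-1) powi (m + n)) ^ 4 * ee ((of_int x / 2 * of_int n - of_int y / 2 * of_int m + of_int (m * n)) / 2) ^ 4 * \<kappa> x y"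
      unfolding \<kappa>_def klein_shift[OF z] by (simp add: power_mult_distrib)
    also have "((-1::complex) powi (m + n)) ^ 4 = 1" by (simp add: minus_one_powi)
    also have "ee ((of_int x / 2 * of_int n - of_int y / 2 * of_int m + of_int (m * n)) / 2) ^ 4
       = ee (of_int (x * n - y * m + 2 * m * n))"
      unfolding ee_power by (rule arg_cong[of _ _ ee]) (simp add: field_simps)
    finally show ?thesis unfolding ee_of_int by (simp add: \<kappa>_def add_divide_distrib)
  qed
  have \<kappa>mod: "\<kappa> x y = \<kappa> (x mod 2) (y mod 2)" for x y
    using \<kappa>[of "x mod 2" "x div 2" "y mod 2" "y div 2"] by simp
  have k: "klein (of_int x / 2) (of_int y / 2) \<tau> ^ 4 = inverse j ^ 4 * \<kappa> (x * a + y * c) (x * b + y * d)" for x y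
    using klein_modular[OF z det, of "of_int x / 2" "of_int y / 2"]
    unfolding j_def[symmetric] \<tau>_def[symmetric]
    by (simp add: \<kappa>_def power_mult_distrib add_divide_distrib)
  \<comment> \<open>The three arguments on the left are the images of (0, 1), (1, 0) and (1, 1).
    Modulo 2 the matrix is invertible, so it permutes the nonzero vectors.\<close>
  have perm: "\<kappa> c d * \<kappa> a b * \<kappa> (a + c) (b + d) = \<kappa> 0 1 * \<kappa> 1 0 * \<kappa> 1 1"
  proof -
    have "odd (a * d - b * c)" using det by simp
    hence od: "(odd a \<and> odd d) \<noteq> (odd b \<and> odd c)" by auto
    have m: "x mod 2 = (if even x then 0 else 1)" for x :: int by (simp add: even_iff_mod_2_eq_zero odd_iff_mod_2_eq_one)
    show ?thesis
      unfolding \<kappa>mod[of c d] \<kappa>mod[of a b] \<kappa>mod[of "a + c"] m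
      using od by (cases "even a"; cases "even b"; cases "even c"; cases "even d") (simp_all add: mult_ac)
  qed
  have W: "(klein 0 (1/2) \<tau> * klein (1/2) 0 \<tau> * klein (1/2) (1/2) \<tau>) ^ 4 =
      inverse j ^ 12 * (klein 0 (1/2) z * klein (1/2) 0 z * klein (1/2) (1/2) z) ^ 4"
  proof -
    have "(klein 0 (1/2) \<tau> * klein (1/2) 0 \<tau> * klein (1/2) (1/2) \<tau>) ^ 4 =
        (inverse j ^ 4 * \<kappa> c d) * (inverse j ^ 4 * \<kappa> a b) * (inverse j ^ 4 * \<kappa> (a + c) (b + d))"
      using k[of 0 1] k[of 1 0] k[of 1 1] by (simp add: power_mult_distrib)
    also have "\<dots> = inverse j ^ 12 * (\<kappa> c d * \<kappa> a b * \<kappa> (a + c) (b + d))"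
      by (simp add: eval_nat_numeral)
    finally show ?thesis unfolding perm by (simp add: \<kappa>_def power_mult_distrib)
  qed
  define K where "K = (klein 0 (1/2) z * klein (1/2) 0 z * klein (1/2) (1/2) z) ^ 4"
  have "inverse j ^ 12 * K * delta \<tau> = - 16" "K * delta z = -16"
    using klein_half_prod[OF \<tau>] klein_half_prod[OF z] W by (simp_all add: K_def)
  hence "K \<noteq> 0" "K * (inverse j ^ 12 * delta \<tau>) = K * delta z" by (auto simp: mult_ac)
  hence "inverse j ^ 12 * delta \<tau> = delta z" by simp
  hence "delta \<tau> = j ^ 12 * delta z" using j0 by (simp add: field_simps)
  thus ?thesis by (simp only: j_def \<tau>_def)
qed

section \<open>The eta quotient of level p squared\<close>

text \<open>Up to a constant this is \<open>\<eta>(p z) / \<eta>(z)\<^sup>p\<close>.\<close>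
definition jac_prod :: "nat \<Rightarrow> complex \<Rightarrow> complex" where
  "jac_prod p z = (\<Prod>l = 1..(p - 1) div 2. jac (of_nat l / of_nat p) z)"

text \<open>The second Pochhammer symbol of \<open>jac\<close> at \<open>l / p\<close> is the first
  one at \<open>(p - l) / p\<close>. Hence every nontrivial \<open>p\<close>-th root of unity occurs
  exactly once, and \<open>prod_qpoch_roots_of_unity\<close> collapses the product to level
  \<open>p\<close>.\<close>

lemma jac_prod_eq:
  assumes "odd p" "Im z > 0"
  defines "C \<equiv> (\<Prod>l = 1..(p - 1) div 2. - ee (- (of_nat l / of_nat p) / 2) * (1 - ee (of_nat l / of_nat p)))"
  shows "jac_prod p z = C * euler_prod (of_nat p * z) / euler_prod z ^ p"
proof -
  define h where "h = (p - 1) div 2"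
  have p: "p = 2 * h + 1" using assms(1) by (auto simp: h_def elim!: oddE)
  have p0: "p > 0" using p by simp
  have lep: "l \<le> p" if "l \<in> {1..h}" for l using that p by simp
  define q where "q = ee z"
  have q: "norm q < 1" unfolding q_def using assms(2) by (rule norm_ee_less_1)
  have E0: "euler_prod z \<noteq> 0" by (rule euler_prod_neq_0[OF assms(2)])
  define A where "A l = qpoch (ee (of_nat l / of_nat p) * q) q" for l
  have jac: "jac (of_nat l / of_nat p) z =
      (- ee (- (of_nat l / of_nat p) / 2) * (1 - ee (of_nat l / of_nat p))) * (A l * A (p - l)) / euler_prod z ^ 2"
    if "l \<in> {1..h}" for l
  proof -
    have "ee (of_nat (p - l) / of_nat p) = ee (- (of_nat l / of_nat p))"
    proof -
      have "of_nat (p - l) / of_nat p = 1 + - (of_nat l / of_nat p :: complex)"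
        using that p0 lep[OF that] by (simp add: of_nat_diff diff_divide_distrib)
      thus ?thesis by (simp only: ee_add ee_1 mult_1)
    qed
    hence "A (p - l) = qpoch (ee (z - of_nat l / of_nat p)) q"
      by (simp add: A_def q_def ee_diff ee_minus divide_inverse mult.commute)
    thus ?thesis unfolding jac_def q_def[symmetric]
      by (subst qpoch_rec[OF q]) (simp add: A_def)
  qed
  have "jac_prod p z = C * (\<Prod>l=1..h. A l * A (p - l)) / (euler_prod z ^ 2) ^ h"
  proof -
    have "jac_prod p z = (\<Prod>l=1..h. (- ee (- (of_nat l / of_nat p) / 2) * (1 - ee (of_nat l / of_nat p))) *
        (A l * A (p - l)) / euler_prod z ^ 2)"
      unfolding jac_prod_def h_def[symmetric] by (rule prod.cong[OF refl jac])
    thus ?thesis unfolding C_def h_def[symmetric] prod_dividef prod.distrib by simp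
  qed
  also have "(\<Prod>l=1..h. A l * A (p - l)) = (\<Prod>l=1..<p. A l)"
  proof -
    have "(\<Prod>l=1..h. A (p - l)) = (\<Prod>l=h+1..<p. A l)"
      by (rule prod.reindex_bij_witness[of _ "\<lambda>l. p - l" "\<lambda>l. p - l"]) (auto simp: p)
    moreover have "{1..<p} = {1..h} \<union> {h+1..<p}" by (auto simp: p)
    hence "(\<Prod>l=1..<p. A l) = (\<Prod>l=1..h. A l) * (\<Prod>l=h+1..<p. A l)"
      by (simp only:) (rule prod.union_disjoint, auto)
    ultimately show ?thesis by (simp add: prod.distrib)
  qed
  also have "(\<Prod>l=1..<p. A l) = euler_prod (of_nat p * z) / euler_prod z"
  proof -
    have "{..<p} = insert 0 {1..<p}" by (auto simp: p)
    hence "(\<Prod>l<p. A l) = A 0 * (\<Prod>l=1..<p. A l)" by simp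
    moreover have "(\<Prod>l<p. A l) = euler_prod (of_nat p * z)"
      unfolding A_def using prod_qpoch_roots_of_unity[OF p0 q, of q]
      by (simp add: euler_prod_def q_def ee_power)
    moreover have "A 0 = euler_prod z" by (simp add: A_def q_def euler_prod_def)
    ultimately show ?thesis using E0 by (simp add: field_simps)
  qed
  finally show ?thesis by (simp add: p power_mult)
qed

text \<open>As the lower left entry is divisible by \<open>p\<close>, the characteristic
  \<open>(0, l / p)\<close> is mapped to \<open>(l * c, l * d / p)\<close>. Its first coordinate is
  an integer and is removed by \<open>klein_shift\<close> at the cost of a root of unity.\<close>

lemma jac_torsion_modular:
  fixes z :: complex and a b c d :: int
  assumes z: "Im z > 0" and det: "a * d - b * (int p * c) = 1" and p: "p > 0"
  defines "j \<equiv> of_int (int p * c) * z + of_int d"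
  shows "jac (of_nat l / of_nat p) ((of_int a * z + of_int b) / j) =
    inverse j * (-1) powi (int l * c) * ee (- (of_nat l ^ 2 * of_int c * of_int d / of_nat p) / 2) *
    jac (of_nat l * of_int d / of_nat p) z"
proof -
  have e1: "of_nat l / of_nat p * of_int (int p * c) = 0 + (of_int (int l * c) :: complex)"
    using p by simp
  have e2: "of_nat l / of_nat p * of_int d = (of_nat l * of_int d / of_nat p + of_int 0 :: complex)" by simp
  have "jac (of_nat l / of_nat p) ((of_int a * z + of_int b) / j) =
     inverse j * klein (0 * of_int a + of_nat l / of_nat p * of_int (int p * c)) (0 * of_int b + of_nat l / of_nat p * of_int d) z"
    unfolding klein_0[symmetric] j_def by (rule klein_modular[OF z det])
  also have "\<dots> = inverse j * klein (0 + of_int (int l * c)) (of_nat l * of_int d / of_nat p + of_int 0) z"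
    unfolding e1 e2 by simp
  also have "\<dots> = inverse j * ((-1) powi (int l * c) * ee (- (of_nat l ^ 2 * of_int c * of_int d / of_nat p) / 2) *
      klein 0 (of_nat l * of_int d / of_nat p) z)"
    unfolding klein_shift[OF z] by (simp add: power2_eq_square mult_ac)
  finally show ?thesis by (simp add: klein_0 mult_ac)
qed

text \<open>As in Gauss' lemma, multiplication by \<open>d\<close> permutes the half system of residues up to signs.\<close>
lemma jac_prod_mult:
  fixes d :: int
  assumes p: "prime p" "odd p" and d: "\<not> int p dvd d"
  obtains \<sigma> :: complex where "\<sigma> ^ 2 = 1"
    "\<And>z. Im z > 0 \<Longrightarrow> (\<Prod>l = 1..(p - 1) div 2. jac (of_nat l * of_int d / of_nat p) z) = \<sigma> * jac_prod p z"
proof -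
  define h where "h = (p - 1) div 2"
  have ph: "p = 2 * h + 1" using assms(2) by (auto simp: h_def elim!: oddE)
  have p0: "p > 0" using ph by simp
  define r where "r l = (int l * d) mod int p" for l
  \<comment> \<open>\<open>\<rho> l\<close> represents \<open>l * d\<close> modulo \<open>p\<close>
    up to sign in the half system \<open>{1..h}\<close>.\<close>
  define \<rho> where "\<rho> l = nat (if r l \<le> int h then r l else int p - r l)" for l
  define \<epsilon> where "\<epsilon> l = (-1::complex) powi ((int l * d) div int p)" for l
  have nd: "\<not> int p dvd int l * d" if "l \<in> {1..h}" for l
  proof -
    have "\<not> int p dvd int l" using that ph by (auto dest: zdvd_imp_le)
    thus ?thesis using d p prime_dvd_mult_iff[of "int p"] by auto
  qed
  have r: "0 < r l" "r l < int p" if "l \<in> {1..h}" for l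
    using nd[OF that] ph pos_mod_bound[of "int p" "int l * d"] pos_mod_sign[of "int p" "int l * d"]
    by (auto simp: r_def dvd_eq_mod_eq_0 simp del: pos_mod_bound pos_mod_sign)
  have jac: "jac (of_nat l * of_int d / of_nat p) z = \<epsilon> l * jac (of_nat (\<rho> l) / of_nat p) z"
    if "l \<in> {1..h}" "Im z > 0" for l z
  proof -
    have "of_int (int l * d) = (of_int (r l) + of_int p * of_int ((int l * d) div int p) :: complex)"
      unfolding r_def of_int_mult[symmetric] of_int_add[symmetric] by (simp add: add.commute)
    hence 1: "of_nat l * of_int d / of_nat p = (of_int (r l) / of_nat p + of_int ((int l * d) div int p) :: complex)"
      using p0 by (simp add: field_simps)
    \<comment> \<open>Reflection costs no sign, because oddness and the sign of the shift by 1
      cancel. The sign \<open>\<epsilon> l\<close> comes from the integral quotient alone and does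
      not depend on \<open>z\<close>.\<close>
    have 2: "jac (of_int (r l) / of_nat p) z = jac (of_nat (\<rho> l) / of_nat p) z"
    proof (cases "r l \<le> int h")
      case True
      hence "(of_nat (\<rho> l) :: complex) = of_int (r l)" using r[OF that(1)] by (simp add: \<rho>_def)
      thus ?thesis by simp
    next
      case False
      hence "(of_nat (\<rho> l) :: complex) = of_nat p - of_int (r l)" using r[OF that(1)] by (simp add: \<rho>_def)
      hence "of_nat (\<rho> l) / of_nat p = - (of_int (r l) / of_nat p) + (1::complex)"
        using p0 by (simp add: field_simps)
      thus ?thesis by (simp only: jac_plus_1 jac_uminus[OF that(2)]) simp
    qed
    show ?thesis unfolding 1 jac_plus_int 2 by (simp add: \<epsilon>_def)
  qed
  have inj: "inj_on \<rho> {1..h}"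
  proof (rule inj_onI)
    fix x y assume xy: "x \<in> {1..h}" "y \<in> {1..h}" "\<rho> x = \<rho> y"
    \<comment> \<open>Equal representatives force \<open>x\<close> to be congruent to
      \<open>y\<close> or to \<open>- y\<close>; the latter is impossible as
      \<open>0 < x + y < p\<close>.\<close>
    hence "r x = r y \<or> r x + r y = int p"
      using r[OF xy(1)] r[OF xy(2)] by (auto simp: \<rho>_def split: if_splits)
    hence "int p dvd (int x - int y) * d \<or> int p dvd (int x + int y) * d"
    proof
      assume "r x = r y"
      hence "int p dvd int x * d - int y * d" unfolding r_def by (simp add: mod_eq_dvd_iff)
      thus ?thesis by (simp add: algebra_simps)
    next
      assume "r x + r y = int p"
      hence "(int x * d + int y * d) mod int p = 0" unfolding r_def by (metis mod_add_eq mod_self)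
      thus ?thesis by (simp add: algebra_simps mod_eq_0_iff_dvd)
    qed
    hence "int p dvd int x - int y \<or> int p dvd int x + int y"
      using d p prime_dvd_mult_iff[of "int p"] by auto
    moreover have "\<not> int p dvd int x + int y"
      using xy ph by (auto dest!: zdvd_imp_le)
    ultimately have "int p dvd int x - int y" by simp
    moreover have "\<bar>int x - int y\<bar> < int p" using xy ph by auto
    ultimately have "int x - int y = 0" using dvd_imp_le_int[of "int x - int y" "int p"] by linarith
    thus "x = y" by simp
  qed
  have "\<rho> ` {1..h} \<subseteq> {1..h}"
  proof safe
    fix l assume "l \<in> {1..h}"
    from r[OF this] show "\<rho> l \<in> {1..h}" using ph by (auto simp: \<rho>_def)
  qed
  hence bij: "bij_betw \<rho> {1..h} {1..h}"
    using inj by (simp add: bij_betw_def endo_inj_surj)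
  show ?thesis
  proof (rule that[of "\<Prod>l=1..h. \<epsilon> l"])
    have "\<epsilon> l ^ 2 = 1" for l by (auto simp: \<epsilon>_def minus_one_powi)
    thus "(\<Prod>l=1..h. \<epsilon> l) ^ 2 = 1" by (simp add: prod_power_distrib)
    fix z :: complex assume z: "Im z > 0"
    have "(\<Prod>l=1..h. jac (of_nat l * of_int d / of_nat p) z) =
        (\<Prod>l=1..h. \<epsilon> l) * (\<Prod>l=1..h. jac (of_nat (\<rho> l) / of_nat p) z)"
      using jac[OF _ z] by (simp add: prod.distrib)
    also have "(\<Prod>l=1..h. jac (of_nat (\<rho> l) / of_nat p) z) = jac_prod p z"
      unfolding jac_prod_def h_def[symmetric]
      by (rule prod.reindex_bij_betw[OF bij, of "\<lambda>l. jac (of_nat l / of_nat p) z"])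
    finally show "(\<Prod>l = 1..(p - 1) div 2. jac (of_nat l * of_int d / of_nat p) z) =
        (\<Prod>l=1..h. \<epsilon> l) * jac_prod p z"
      by (simp add: h_def)
  qed
qed

text \<open>The eta quotient \<open>\<eta>(p\<^sup>2 z) / \<eta>(z)\<close>.\<close>
definition eta_quot :: "nat \<Rightarrow> complex \<Rightarrow> complex" where
  "eta_quot p z = ee (of_int (s_p p) * z) * euler_prod (of_nat p ^ 2 * z) / euler_prod z"

text \<open>With \<open>p = 2 * h + 1\<close> everything reduces to \<open>h * (h + 1)\<close> being
  divisible by 6. The two sums are the exponents that appear when the root-of-unity factors of
  \<open>jac_torsion_modular\<close> are multiplied over the half system.\<close>

lemma prime_square_minus_one:
  assumes "prime p" "p > 3"
  obtains s where "s_p p = int s" "24 * s + 1 = p ^ 2" "(\<Sum>l=1..(p - 1) div 2. l) = 3 * s"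
    "(\<Sum>l=1..(p - 1) div 2. l ^ 2) = p * s"
proof -
  define h where "h = (p - 1) div 2"
  have "odd p" using assms prime_odd_nat[of p] by simp
  hence p: "p = 2 * h + 1" by (auto simp: h_def elim!: oddE)
  have "\<not> 3 dvd p" using assms primes_dvd_imp_eq[of 3 p] by auto
  hence "3 dvd h * (h + 1)"
  proof -
    have "h mod 3 = 0 \<or> h mod 3 = 1 \<or> h mod 3 = 2" by linarith
    moreover have "h mod 3 \<noteq> 1" using \<open>\<not> 3 dvd p\<close> p by presburger
    ultimately have "3 dvd h \<or> 3 dvd h + 1" by presburger
    thus ?thesis by (metis dvd_mult dvd_mult2)
  qed
  moreover have "2 dvd h * (h + 1)" by simp
  ultimately have "6 dvd h * (h + 1)" by presburger
  then obtain s where s: "h * (h + 1) = 6 * s" by blast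
  have p2: "24 * s + 1 = p ^ 2" using s by (simp add: p power2_eq_square algebra_simps)
  hence "(int p)\<^sup>2 = 24 * int s + 1" by (metis of_nat_power of_nat_add of_nat_mult of_nat_numeral of_nat_1)
  hence sp: "s_p p = int s" by (simp add: s_p_def)
  have "2 * (\<Sum>l=1..h. l) = h * (h + 1)" by (induction h) auto
  moreover have "6 * (\<Sum>l=1..h. l ^ 2) = h * (h + 1) * (2 * h + 1)"
    by (induction h) (auto simp: algebra_simps power2_eq_square)
  ultimately have "(\<Sum>l=1..h. l) = 3 * s" "(\<Sum>l=1..h. l ^ 2) = p * s"
    unfolding s by (simp_all add: p algebra_simps)
  thus ?thesis using that[of s] sp p2 by (simp add: h_def)
qed

text \<open>The quotient is a product of \<open>delta\<close> and of values of
  \<open>jac_prod\<close> at \<open>z\<close> and \<open>p * z\<close>. All of these have explicit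
  transformation laws under this matrix, and the automorphy factors and signs cancel
  separately.\<close>

lemma eta_quot_modular:
  fixes z :: complex and a b d :: int
  assumes p: "prime p" "p > 3" and z: "Im z > 0" and det: "a * d - b * (int p ^ 2) = 1"
  shows "eta_quot p ((of_int a * z + of_int b) / (of_nat p ^ 2 * z + of_int d)) = eta_quot p z"
proof -
  have oddp: "odd p" using p prime_odd_nat[of p] by simp
  obtain s where s: "s_p p = int s" "24 * s + 1 = p ^ 2" "(\<Sum>l=1..(p - 1) div 2. l) = 3 * s"
    "(\<Sum>l=1..(p - 1) div 2. l ^ 2) = p * s"
    using prime_square_minus_one[OF p] .
  define h where "h = (p - 1) div 2"
  have ph: "p = 2 * h + 1" using oddp by (auto simp: h_def elim!: oddE)
  define C :: complex where "C = (\<Prod>l = 1..(p - 1) div 2. - ee (- (of_nat l / of_nat p) / 2) * (1 - ee (of_nat l / of_nat p)))"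
  have C0: "C \<noteq> 0"
  proof -
    have "ee (of_nat l / of_nat p) \<noteq> 1" if "l \<in> {1..h}" for l
    proof
      assume "ee (of_nat l / of_nat p) = 1"
      then obtain n :: int where "of_nat l / of_nat p = (of_int n :: complex)" by (auto simp: ee_eq_1_iff)
      hence "(of_int (int l) :: complex) = of_int (n * int p)" using p(2) by (simp add: field_simps)
      hence "int l = n * int p" by (simp only: of_int_eq_iff)
      hence "int p dvd int l" by simp
      thus False using that ph by (auto dest!: zdvd_imp_le)
    qed
    thus ?thesis unfolding C_def h_def by auto
  qed
  \<comment> \<open>The Euler product at \<open>p * w\<close> cancels between the two
    \<open>jac_prod\<close> factors; at \<open>w\<close> the exponent is
    \<open>24 * s - p ^ 2 = -1\<close>.\<close>
  have u: "eta_quot p w * C ^ (p + 1) = delta w ^ s * jac_prod p (of_nat p * w) * jac_prod p w ^ p" if w: "Im w > 0" for w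
  proof -
    have pw: "Im (of_nat p * w) > 0" using w ph by simp
    define E E1 E2 where "E = euler_prod w" and "E1 = euler_prod (of_nat p * w)" and "E2 = euler_prod (of_nat p ^ 2 * w)"
    have nz: "E \<noteq> 0" "E1 \<noteq> 0" using euler_prod_neq_0 w pw by (auto simp: E_def E1_def)
    have 1: "jac_prod p w = C * E1 / E ^ p" using jac_prod_eq[OF oddp w] by (simp add: C_def E_def E1_def)
    have 2: "jac_prod p (of_nat p * w) = C * E2 / E1 ^ p" using jac_prod_eq[OF oddp pw]
      by (simp add: C_def E2_def E1_def power2_eq_square mult_ac)
    have "p * p = Suc (24 * s)" using s(2) by (simp add: power2_eq_square)
    hence "(E ^ p) ^ p = E * E ^ (24 * s)" by (simp add: power_mult[symmetric])
    moreover have "delta w ^ s = ee (of_nat s * w) * E ^ (24 * s)"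
      by (simp add: delta_def E_def power_mult_distrib ee_power power_mult)
    moreover have "eta_quot p w = ee (of_nat s * w) * E2 / E"
      by (simp add: eta_quot_def s(1) E_def E2_def)
    ultimately show ?thesis unfolding 1 2 using nz
      by (simp add: power_mult_distrib power_divide field_simps)
  qed
  define j where "j = of_nat p ^ 2 * z + of_int d"
  define \<tau> where "\<tau> = (of_int a * z + of_int b) / j"
  have pz: "Im (of_nat p * z) > 0" using z ph by simp
  have j0: "j \<noteq> 0" and \<tau>: "Im \<tau> > 0"
    using Im_moebius_pos[OF z, of a d b "int p ^ 2"] det by (auto simp: j_def \<tau>_def)
  have nd: "\<not> int p dvd d"
  proof
    assume "int p dvd d"
    hence "int p dvd a * d - b * (int p ^ 2)" by (simp add: power2_eq_square)
    thus False using det p by simp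
  qed
  obtain \<sigma> :: complex where \<sigma>: "\<sigma> ^ 2 = 1"
    "\<And>z. Im z > 0 \<Longrightarrow> (\<Prod>l = 1..(p - 1) div 2. jac (of_nat l * of_int d / of_nat p) z) = \<sigma> * jac_prod p z"
    by (rule jac_prod_mult[OF p(1) oddp nd], rule that, assumption, blast)
  \<comment> \<open>At \<open>z\<close> the lower left entry is \<open>p * p\<close>, so the
    denominator of the exponent cancels in each factor.\<close>
  have c: "(\<Prod>l=1..h. (-1) powi (int l * int p) * ee (- (of_nat l ^ 2 * of_int (int p) * of_int d / of_nat p) / 2))
     = (-1) powi (3 * int s * (1 + d))"
  proof -
    have "(-1) powi (int l * int p) * ee (- (of_nat l ^ 2 * of_int (int p) * of_int d / of_nat p) / 2)
       = ((-1) powi (1 + d)) ^ l" for l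
    proof -
      have "- (of_nat l ^ 2 * of_int (int p) * of_int d / of_nat p) = (of_int (- (int l ^ 2 * d)) :: complex)"
        using p(2) by simp
      thus ?thesis using oddp by (simp only: ee_half_int minus_one_powi) (auto simp: uminus_power_if)
    qed
    hence "(\<Prod>l=1..h. (-1) powi (int l * int p) * ee (- (of_nat l ^ 2 * of_int (int p) * of_int d / of_nat p) / 2))
       = ((-1) powi (1 + d)) ^ (\<Sum>l=1..h. l)"
      by (simp add: power_sum)
    thus ?thesis unfolding h_def s by (auto simp: minus_one_powi uminus_power_if)
  qed
  \<comment> \<open>At \<open>p * z\<close> the lower left entry is only \<open>p\<close>. The
    denominator cancels after multiplication, because the squares in the half system sum to
    \<open>p * s\<close>.\<close>
  have c': "(\<Prod>l=1..h. (-1) powi (int l * 1) * ee (- (of_nat l ^ 2 * of_int 1 * of_int d / of_nat p) / 2))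
     = (-1) powi (3 * int s + int s * d)"
  proof -
    have "(\<Prod>l=1..h. ee (- (of_nat l ^ 2 * of_int 1 * of_int d / of_nat p) / 2)) =
       (\<Prod>l=1..h. ee (- (of_int d / of_nat p) / 2) ^ (l ^ 2))"
      by (intro prod.cong refl) (simp add: ee_power mult_ac)
    also have "\<dots> = ee (- (of_int d / of_nat p) / 2) ^ (p * s)"
      unfolding power_sum[symmetric] using s(4) by (simp add: h_def)
    also have "\<dots> = ee (of_int (- (int s * d)) / 2)"
      unfolding ee_power using p(2) by (intro arg_cong[of _ _ ee]) (simp add: field_simps)
    also have "\<dots> = (-1) powi (int s * d)" by (simp only: ee_half_int minus_one_powi even_minus)
    finally have "(\<Prod>l=1..h. ee (- (of_nat l ^ 2 * of_int 1 * of_int d / of_nat p) / 2)) = (-1) powi (int s * d)" .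
    moreover have "(\<Prod>l=1..h. (-1::complex) powi (int l * 1)) = (-1) powi (3 * int s)"
    proof -
      have "(\<Prod>l=1..h. (-1::complex) powi (int l * 1)) = (-1) ^ (\<Sum>l=1..h. l)" by (simp add: power_sum)
      also have "\<dots> = (-1) powi (3 * int s)" unfolding h_def s by (simp add: minus_one_powi uminus_power_if)
      finally show ?thesis .
    qed
    ultimately show ?thesis by (simp add: prod.distrib power_int_add)
  qed
  have P1: "jac_prod p \<tau> = inverse j ^ h * (-1) powi (3 * int s * (1 + d)) * (\<sigma> * jac_prod p z)"
  proof -
    have "jac_prod p \<tau> = (\<Prod>l=1..h. inverse j * ((-1) powi (int l * int p) *
        ee (- (of_nat l ^ 2 * of_int (int p) * of_int d / of_nat p) / 2)) * jac (of_nat l * of_int d / of_nat p) z)"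
      unfolding jac_prod_def h_def[symmetric]
    proof (intro prod.cong refl)
      fix l
      have "of_int (int p * int p) * z + of_int d = j" by (simp add: j_def power2_eq_square)
      thus "jac (of_nat l / of_nat p) \<tau> = inverse j * ((-1) powi (int l * int p) *
        ee (- (of_nat l ^ 2 * of_int (int p) * of_int d / of_nat p) / 2)) * jac (of_nat l * of_int d / of_nat p) z"
        using jac_torsion_modular[OF z, of a d b p "int p" l] det ph
        by (simp add: \<tau>_def power2_eq_square mult_ac)
    qed
    also have "\<dots> = inverse j ^ h * (-1) powi (3 * int s * (1 + d)) * (\<sigma> * jac_prod p z)"
      unfolding prod.distrib c[unfolded prod.distrib] using \<sigma>(2)[OF z] by (simp add: h_def)
    finally show ?thesis .
  qed
  have P2: "jac_prod p (of_nat p * \<tau>) = inverse j ^ h * (-1) powi (3 * int s + int s * d) * (\<sigma> * jac_prod p (of_nat p * z))"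
  proof -
    have "jac_prod p (of_nat p * \<tau>) = (\<Prod>l=1..h. inverse j * ((-1) powi (int l * 1) *
        ee (- (of_nat l ^ 2 * of_int 1 * of_int d / of_nat p) / 2)) * jac (of_nat l * of_int d / of_nat p) (of_nat p * z))"
      unfolding jac_prod_def h_def[symmetric]
    proof (intro prod.cong refl)
      fix l
      have e: "of_int (int p * 1) * (of_nat p * z) + of_int d = j" by (simp add: j_def power2_eq_square)
      \<comment> \<open>Conjugation by multiplication with \<open>p\<close>: the point
        \<open>p * \<tau>\<close> is the image of \<open>p * z\<close> under the matrix with rows
        \<open>(a, b * p)\<close> and \<open>(p, d)\<close>.\<close>
      have e': "(of_int a * (of_nat p * z) + of_int (b * int p)) / j = of_nat p * \<tau>"
        by (simp add: \<tau>_def algebra_simps)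
      show "jac (of_nat l / of_nat p) (of_nat p * \<tau>) = inverse j * ((-1) powi (int l * 1) *
        ee (- (of_nat l ^ 2 * of_int 1 * of_int d / of_nat p) / 2)) * jac (of_nat l * of_int d / of_nat p) (of_nat p * z)"
        using jac_torsion_modular[OF pz, of a d "b * int p" p 1 l] det ph unfolding e e'
        by (simp add: power2_eq_square mult_ac)
    qed
    also have "\<dots> = inverse j ^ h * (-1) powi (3 * int s + int s * d) * (\<sigma> * jac_prod p (of_nat p * z))"
      unfolding prod.distrib c'[unfolded prod.distrib] using \<sigma>(2)[OF pz] by (simp add: h_def)
    finally show ?thesis .
  qed
  have D: "delta \<tau> = j ^ 12 * delta z"
    using delta_modular[OF z, of a d b "int p ^ 2"] det by (simp add: \<tau>_def j_def)
  \<comment> \<open>The weights balance because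
    \<open>24 * s = p ^ 2 - 1 = 2 * h * (p + 1)\<close>.\<close>
  have jpow: "(j ^ 12) ^ s * inverse j ^ h * (inverse j ^ h) ^ p = 1"
  proof -
    have "12 * s = h + h * p" using s(2) by (simp add: ph power2_eq_square algebra_simps)
    hence "(j ^ 12) ^ s = j ^ h * (j ^ h) ^ p" by (simp add: power_mult[symmetric] power_add[symmetric])
    thus ?thesis using j0 by (simp add: power_inverse field_simps)
  qed
  \<comment> \<open>The same \<open>\<sigma>\<close> occurs at \<open>z\<close> and at
    \<open>p * z\<close>, in total \<open>p + 1\<close> times, an even number. The explicit signs
    have equal parity and cancel likewise.\<close>
  have sgn: "((-1) powi (3 * int s * (1 + d)) * \<sigma>) ^ p * ((-1) powi (3 * int s + int s * d) * \<sigma>) = (1::complex)"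
  proof -
    have "\<sigma> ^ p * \<sigma> = \<sigma> ^ (2 * (h + 1))" by (simp add: ph)
    also have "\<dots> = (\<sigma> ^ 2) ^ (h + 1)" by (simp only: power_mult)
    finally have "\<sigma> ^ p * \<sigma> = (\<sigma> ^ 2) ^ (h + 1)" .
    hence "\<sigma> ^ p * \<sigma> = 1" using \<sigma>(1) by simp
    moreover have "((-1) powi (3 * int s * (1 + d))) ^ p * (-1) powi (3 * int s + int s * d) = (1::complex)"
      using oddp by (auto simp: minus_one_powi)
    ultimately have "(((-1) powi (3 * int s * (1 + d))) ^ p * (-1) powi (3 * int s + int s * d)) * (\<sigma> ^ p * \<sigma>) = 1"
      by simp
    thus ?thesis unfolding power_mult_distrib by (simp only: mult_ac)
  qed
  have "eta_quot p \<tau> * C ^ (p + 1) = 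
     ((j ^ 12) ^ s * inverse j ^ h * (inverse j ^ h) ^ p) *
     (((-1) powi (3 * int s * (1 + d)) * \<sigma>) ^ p * ((-1) powi (3 * int s + int s * d) * \<sigma>)) *
     (delta z ^ s * jac_prod p (of_nat p * z) * jac_prod p z ^ p)"
    unfolding u[OF \<tau>] P1 P2 D power_mult_distrib by (simp add: mult_ac)
  also have "\<dots> = eta_quot p z * C ^ (p + 1)" unfolding jpow sgn u[OF z] by simp
  finally show ?thesis using C0 by (simp add: \<tau>_def j_def)
qed

section \<open>The crank generating function\<close>

definition crank_gf :: "complex \<Rightarrow> complex \<Rightarrow> complex" where
  "crank_gf x q = qpoch q q / (qpoch (x * q) q * qpoch (inverse x * q) q)"

lemma fps_nth_0_prod: "fps_nth (prod f A) 0 = (\<Prod>x\<in>A. fps_nth (f x :: 'a::comm_ring_1 fps) 0)"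
  by (induction A rule: infinite_finite_induct) auto

text \<open>Consecutive truncations satisfy \<open>T' * d = T * (1 - Y)\<close> with
  \<open>d = 1 - Y * e\<close>, so they differ by a multiple of \<open>Y\<close>, the power of
  \<open>fps_X\<close> with exponent \<open>Suc M\<close>. This links the varying truncation in
  \<open>crank_coeff\<close> to one power series.\<close>

lemma crank_fps_trunc_stable:
  assumes "n \<le> M"
  shows "fps_nth (crank_fps_trunc x M) n = fps_nth (crank_fps_trunc x n) n"
  using assms
proof (induction M rule: dec_induct)
  case (step M)
  define N :: "complex fps" where "N = (\<Prod>k\<in>{1..M}. (1 - fps_X ^ k))"
  define D where "D = (\<Prod>k\<in>{1..M}. (1 - fps_const x * fps_X ^ k) * (1 - fps_const (inverse x) * fps_X ^ k))"
  define Y :: "complex fps" where "Y = fps_X ^ Suc M"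
  define d where "d = (1 - fps_const x * Y) * (1 - fps_const (inverse x) * Y)"
  define e where "e = fps_const x + fps_const (inverse x) - fps_const x * fps_const (inverse x) * Y"
  define T T' where "T = crank_fps_trunc x M" and "T' = crank_fps_trunc x (Suc M)"
  have D0: "fps_nth D 0 \<noteq> 0" unfolding D_def by (simp add: fps_nth_0_prod fps_X_power_iff)
  have d0: "fps_nth d 0 \<noteq> 0" by (simp add: d_def Y_def)
  have T: "T = N * inverse D" by (simp add: T_def crank_fps_trunc_def N_def D_def)
  have T': "T' = (N * (1 - Y)) * inverse (D * d)"
    by (simp add: T'_def crank_fps_trunc_def N_def D_def d_def Y_def prod.atLeast_Suc_atMost_Suc_shift mult_ac)
  have DT: "T * D = N" unfolding T using inverse_mult_eq_1[OF D0] by (simp add: mult.assoc)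
  have DT': "T' * (D * d) = N * (1 - Y)"
    unfolding T' using inverse_mult_eq_1[of "D * d"] D0 d0 by (simp add: mult.assoc)
  have "D * (T' * d) = D * (T * (1 - Y))" using DT DT' by (simp add: mult_ac)
  moreover have "D \<noteq> 0" using D0 by auto
  ultimately have "T' * d = T * (1 - Y)" by simp
  moreover have "(1 - A * Y) * (1 - B * Y) = 1 - Y * (A + B - A * B * Y)" for A B :: "complex fps"
    by (simp add: algebra_simps)
  hence "d = 1 - Y * e" unfolding d_def e_def .
  ultimately have "T' = T + Y * (T' * e - T)" by (simp add: algebra_simps)
  hence "fps_nth T' n = fps_nth T n + fps_nth (Y * (T' * e - T)) n" by (metis fps_add_nth)
  also have "fps_nth (Y * (T' * e - T)) n = 0"
    unfolding Y_def fps_X_power_mult_nth using step.hyps by simp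
  finally show ?case using step.IH by (simp add: T_def T'_def)
qed simp

lemma qpoch_unit_mult_neq_0:
  assumes "norm x = 1" "norm q < 1"
  shows "qpoch (x * q) q \<noteq> 0" "qpoch (inverse x * q) q \<noteq> 0"
  using qpoch_neq_0[of q "x * q"] qpoch_neq_0[of q "inverse x * q"] assms
  by (simp_all add: norm_mult norm_inverse)

lemma holomorphic_crank_gf:
  assumes "norm x = 1"
  shows "crank_gf x holomorphic_on ball 0 1"
  unfolding crank_gf_def using assms
  by (intro holomorphic_intros holomorphic_on_qpoch) (auto simp: qpoch_unit_mult_neq_0)

text \<open>The finite quotients converge to \<open>crank_gf x\<close> uniformly near 0, while their
  expansions converge coefficientwise to \<open>F\<close>. Uniform limits of holomorphic functions
  carry Taylor coefficients to the limit, so the two expansions agree.\<close>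

lemma crank_gf_has_fps_expansion:
  assumes x: "norm x = 1"
  defines "F \<equiv> Abs_fps (\<lambda>n. crank_coeff x (int n))"
  shows "crank_gf x has_fps_expansion F"
proof -
  define g where "g = fps_expansion (crank_gf x) 0"
  define S :: "complex set" where "S = cball 0 (1/2)"
  define num :: "nat \<Rightarrow> complex \<Rightarrow> complex" where "num M q = (\<Prod>k<M. 1 - q * q ^ k)" for M q
  define den :: "nat \<Rightarrow> complex \<Rightarrow> complex" where
    "den M q = (\<Prod>k<M. 1 - x * q * q ^ k) * (\<Prod>k<M. 1 - inverse x * q * q ^ k)" for M q
  have x0: "x \<noteq> 0" using x by auto
  have exp: "crank_gf x has_fps_expansion g"
    unfolding g_def by (rule has_fps_expansion_fps_expansion[OF _ _ holomorphic_crank_gf[OF x]]) auto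
  have S1: "norm q < 1" if "q \<in> S" for q using that by (simp add: S_def)
  have den0: "qpoch (x * q) q * qpoch (inverse x * q) q \<noteq> 0" if "q \<in> S" for q
    using qpoch_unit_mult_neq_0[OF x S1[OF that]] by simp
  have bd: "bounded ((\<lambda>q. qpoch (X q) q) ` S)" if "X holomorphic_on ball 0 1" for X
  proof -
    have "(\<lambda>q. qpoch (X q) q) holomorphic_on ball 0 1"
      using that by (intro holomorphic_on_qpoch holomorphic_intros) auto
    hence "continuous_on S (\<lambda>q. qpoch (X q) q)"
      by (rule holomorphic_on_imp_continuous_on[OF holomorphic_on_subset]) (auto simp: S_def)
    thus ?thesis unfolding S_def by (intro compact_imp_bounded compact_continuous_image) auto
  qed
  have numlim: "uniform_limit S num (\<lambda>q. qpoch q q) sequentially"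
    unfolding num_def using S1 by (intro uniform_limit_qpoch continuous_intros) (auto simp: S_def)
  have denlim: "uniform_limit S den (\<lambda>q. qpoch (x * q) q * qpoch (inverse x * q) q) sequentially"
    unfolding den_def using S1
    by (intro uniform_lim_mult uniform_limit_qpoch continuous_intros bd holomorphic_intros) (auto simp: S_def)
  have cden: "continuous_on S (\<lambda>q. qpoch (x * q) q * qpoch (inverse x * q) q)"
  proof -
    have "(\<lambda>q. qpoch (x * q) q * qpoch (inverse x * q) q) holomorphic_on ball 0 1"
      by (intro holomorphic_intros holomorphic_on_qpoch) auto
    thus ?thesis
      by (rule holomorphic_on_imp_continuous_on[OF holomorphic_on_subset]) (auto simp: S_def)
  qed
  \<comment> \<open>The minimum of the limiting denominator on the compact disc is a positive lower
    bound, as needed to divide uniform limits.\<close>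
  obtain q0 where q0: "q0 \<in> S" "\<And>q. q \<in> S \<Longrightarrow>
      norm (qpoch (x * q0) q0 * qpoch (inverse x * q0) q0) \<le> norm (qpoch (x * q) q * qpoch (inverse x * q) q)"
  proof -
    have "compact S" "S \<noteq> {}" by (auto simp: S_def)
    from continuous_attains_inf[OF this continuous_on_norm[OF cden]] that show ?thesis by blast
  qed
  have "uniform_limit S (\<lambda>M q. num M q / den M q) (crank_gf x) sequentially"
    unfolding crank_gf_def using q0 den0[OF q0(1)] bd[of "\<lambda>q. q"]
    by (intro uniform_lim_divide[OF numlim denlim]) (auto simp: zero_less_norm_iff intro!: holomorphic_intros simp del: norm_mult)
  hence lim: "uniform_limit (ball 0 (1/2)) (\<lambda>M q. num M q / den M q) (crank_gf x) sequentially"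
    by (rule uniform_limit_on_subset) (auto simp: S_def)
  have trunc: "(\<lambda>q. num M q / den M q) has_fps_expansion crank_fps_trunc x M" for M
  proof -
    have "(\<lambda>q. (\<Prod>k\<in>{1..M}. (1 - q ^ k)) *
       inverse (\<Prod>k\<in>{1..M}. (1 - x * q ^ k) * (1 - inverse x * q ^ k))) has_fps_expansion crank_fps_trunc x M"
      unfolding crank_fps_trunc_def
      by (intro fps_expansion_intros) (auto simp: fps_nth_0_prod fps_X_power_iff)
    also have "(\<lambda>q. (\<Prod>k\<in>{1..M}. (1 - q ^ k)) *
       inverse (\<Prod>k\<in>{1..M}. (1 - x * q ^ k) * (1 - inverse x * q ^ k))) = (\<lambda>q. num M q / den M q)"
    proof
      fix q
      have s: "(\<Prod>k\<in>{1..M}. f k) = (\<Prod>k<M. f (Suc k))" for f :: "nat \<Rightarrow> complex"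
        by (rule prod.reindex_bij_witness[of _ Suc "\<lambda>k. k - 1"]) auto
      show "(\<Prod>k\<in>{1..M}. (1 - q ^ k)) *
       inverse (\<Prod>k\<in>{1..M}. (1 - x * q ^ k) * (1 - inverse x * q ^ k)) = num M q / den M q"
        unfolding s num_def den_def by (simp add: prod.distrib divide_inverse mult.assoc)
    qed
    finally show ?thesis .
  qed
  have "g = F"
  proof (rule uniform_limit_imp_fps_expansion_eq[OF _ lim _ exp])
    show "crank_fps_trunc x \<longlonglongrightarrow> F"
      unfolding tendsto_fps_iff
    proof
      fix n
      show "\<forall>\<^sub>F M in sequentially. fps_nth (crank_fps_trunc x M) n = fps_nth F n"
        using eventually_ge_at_top[of n]
      proof eventually_elim
        case (elim M)
        thus ?case using crank_fps_trunc_stable[OF elim, of x] by (simp add: F_def crank_coeff_def)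
      qed
    qed
    have nz: "1 - y * q * q ^ k \<noteq> 0" if "norm y = 1" "q \<in> ball 0 (1/2)" for y q :: complex and k
    proof -
      have "norm (q * q ^ k) \<le> norm q" using that power_le_one[of "norm q" k]
        by (simp add: norm_mult norm_power mult_left_le)
      hence "norm (y * q * q ^ k) < 1" using that by (simp add: norm_mult)
      thus ?thesis by (metis eq_iff_diff_eq_0 less_irrefl norm_one)
    qed
    show "\<forall>\<^sub>F M in sequentially. (\<lambda>q. num M q / den M q) holomorphic_on ball 0 (1/2)"
      unfolding num_def den_def using nz[OF x] nz[of "inverse x"] x
      by (intro always_eventually allI holomorphic_intros) (auto simp: norm_inverse)
  qed (use trunc in auto)
  thus ?thesis using exp by simp
qed

text \<open>Holomorphy on the unit disc gives radius of convergence at least 1, hence absolute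
  convergence. Zero coefficients at negative indices allow summation over all integers, where the
  shift by \<open>s\<close> is a bijection.\<close>

lemma crank_gf_has_sum:
  assumes x: "norm x = 1" and w: "Im w > 0"
  shows "((\<lambda>n. crank_coeff x (n - s) * ee (of_int n * w)) has_sum ee (of_int s * w) * crank_gf x (ee w)) UNIV"
proof -
  define F where "F = Abs_fps (\<lambda>n. crank_coeff x (int n))"
  have q: "norm (ee w) < 1" using w by (rule norm_ee_less_1)
  have exp: "crank_gf x has_fps_expansion F" unfolding F_def using crank_gf_has_fps_expansion[OF x] .
  have holo: "crank_gf x holomorphic_on eball 0 1"
    using holomorphic_crank_gf[OF x] by (simp add: eball_def ball_def one_ereal_def)
  have "(\<lambda>n. fps_nth F n * ee w ^ n) sums crank_gf x (ee w)"
    using has_fps_expansion_imp_sums_complex[OF exp holo] q by (simp add: one_ereal_def)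
  moreover have "fps_conv_radius F \<ge> 1"
    using holomorphic_on_imp_fps_conv_radius_ge[OF exp holo] .
  hence "ereal (norm (ee w)) < fps_conv_radius F" using q by (metis ereal_less(3) less_le_trans)
  hence "summable (\<lambda>n. norm (fps_nth F n * ee w ^ n))" by (rule norm_summable_fps)
  ultimately have "((\<lambda>n. crank_coeff x (int n) * ee (of_nat n * w)) has_sum crank_gf x (ee w)) UNIV"
    using norm_summable_imp_has_sum by (fastforce simp: F_def ee_power)
  hence "((\<lambda>n. crank_coeff x n * ee (of_int n * w)) has_sum crank_gf x (ee w)) (range int)"
    by (subst has_sum_reindex) (auto simp: o_def)
  hence "((\<lambda>n. crank_coeff x n * ee (of_int n * w)) has_sum crank_gf x (ee w)) UNIV"
  proof (rule has_sum_cong_neutral[THEN iffD1, rotated -1])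
    fix n :: int assume "n \<in> UNIV - range int"
    hence "n < 0" by (metis DiffD2 int_nat_eq not_le rangeI)
    thus "crank_coeff x n * ee (of_int n * w) = 0" by (simp add: crank_coeff_def)
  qed auto
  hence "((\<lambda>n. crank_coeff x (n - s) * ee (of_int (n - s) * w)) has_sum crank_gf x (ee w)) UNIV"
    by (subst has_sum_reindex_bij_witness[where i = "\<lambda>n. n + s" and j = "\<lambda>n. n - s"]) auto
  from has_sum_cmult_right[OF this, of "ee (of_int s * w)"] show ?thesis
    by (simp add: ee_diff left_diff_distrib)
qed

section \<open>Extraction of an arithmetic progression by roots of unity\<close>

lemma has_sum_finite_sum:
  fixes f :: "'b \<Rightarrow> 'a \<Rightarrow> complex"
  assumes "finite I" "\<And>i. i \<in> I \<Longrightarrow> (f i has_sum s i) A"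
  shows "((\<lambda>n. \<Sum>i\<in>I. f i n) has_sum (\<Sum>i\<in>I. s i)) A"
  using assms by (induction I rule: finite_induct) (auto intro!: has_sum_add)

lemma ee_cong:
  assumes "int p dvd x - y" "p > 0"
  shows "ee (of_int x / of_nat p) = ee (of_int y / of_nat p)"
proof -
  from assms(1) obtain t where t: "x = y + int p * t" by (metis dvdE diff_add_cancel add.commute)
  have "of_int x / of_nat p = of_int y / of_nat p + (of_int t :: complex)"
    using assms(2) by (simp add: t field_simps)
  thus ?thesis by (simp add: ee_add)
qed

lemma sum_roots_of_unity:
  assumes "p > 0"
  shows "(\<Sum>j<p. ee (of_int n * of_nat j / of_nat p)) = (if int p dvd n then of_nat p else 0)"
proof (cases "int p dvd n")
  case True
  have "ee (of_int n * of_nat j / of_nat p) = 1" for j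
    using ee_cong[of p "n * int j" 0] True assms by simp
  thus ?thesis using True by simp
next
  case False
  define r where "r = ee (of_int n / of_nat p)"
  have "r \<noteq> 1"
  proof
    assume "r = 1"
    then obtain t :: int where "of_int n / of_nat p = (of_int t :: complex)" by (auto simp: r_def ee_eq_1_iff)
    hence "(of_int n :: complex) = of_int (t * int p)" using assms by (simp add: field_simps)
    hence "n = t * int p" by (simp only: of_int_eq_iff)
    thus False using False by simp
  qed
  moreover have "r ^ p = 1" using assms by (simp add: r_def ee_power)
  ultimately have "(\<Sum>j<p. r ^ j) = 0" by (simp add: geometric_sum)
  moreover have "r ^ j = ee (of_int n * of_nat j / of_nat p)" for j
    by (simp add: r_def ee_power mult_ac)
  ultimately show ?thesis using False by simp
qed

text \<open>For \<open>x = zeta p ^ l\<close> this is the function \<open>G_l\<close>, whose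
  \<open>q\<close>-expansion contains the series of \<open>K_crank p m x\<close> for every residue
  \<open>m\<close>.\<close>

definition crank_form :: "nat \<Rightarrow> complex \<Rightarrow> complex \<Rightarrow> complex" where
  "crank_form p x w = ee (of_int (s_p p) * w) * euler_prod (of_nat p ^ 2 * w) * crank_gf x (ee w)"

text \<open>Averaging over the translates of \<open>z / p\<close> selects the exponents congruent to \<open>m\<close>.\<close>
lemma K_crank_eq_sum:
  assumes x: "norm x = 1" and z: "Im z > 0" and p: "p > 0"
  shows "K_crank p m x z = (\<Sum>j<p. ee (- (of_int m * of_nat j / of_nat p)) * crank_form p x ((z + of_nat j) / of_nat p)) / of_nat p"
proof -
  define s where "s = s_p p"
  define E where "E = euler_prod (of_nat p * z)"
  define S where "S j = ee (of_int s * ((z + of_nat j) / of_nat p)) * crank_gf x (ee ((z + of_nat j) / of_nat p))" for j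
  have q1: "qpow z r = ee (r * z)" for r by (simp add: qpow_def ee_def mult_ac)
  have prod: "(\<Prod>n. 1 - qpow z (of_nat (p * Suc n))) = E"
  proof -
    have "qpow z (of_nat (p * Suc n)) = ee (of_nat p * z) * ee (of_nat p * z) ^ n" for n
      unfolding ee_power ee_add[symmetric] q1 by (rule arg_cong[of _ _ ee]) (simp add: algebra_simps)
    thus ?thesis by (simp add: E_def euler_prod_def qpoch_def)
  qed
  \<comment> \<open>The Euler product sees only \<open>p ^ 2 * w\<close> modulo 1, so it takes the
    same value at all translates and factors out of the average.\<close>
  have form: "crank_form p x ((z + of_nat j) / of_nat p) = E * S j" for j
  proof -
    have "of_nat p ^ 2 * ((z + of_nat j) / of_nat p) = of_nat p * z + of_int (int (p * j))"
      using p by (simp add: field_simps power2_eq_square)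
    hence "euler_prod (of_nat p ^ 2 * ((z + of_nat j) / of_nat p)) = E"
      unfolding E_def euler_prod_def by (simp only: ee_add ee_of_int mult_1_right)
    thus ?thesis by (simp add: crank_form_def S_def s_def)
  qed
  have "((\<lambda>n. \<Sum>j<p. ee (- (of_int m * of_nat j / of_nat p)) *
       (crank_coeff x (n - s) * ee (of_int n * ((z + of_nat j) / of_nat p)))) has_sum
       (\<Sum>j<p. ee (- (of_int m * of_nat j / of_nat p)) * S j)) UNIV"
    unfolding S_def using z p
    by (intro has_sum_finite_sum has_sum_cmult_right crank_gf_has_sum x) auto
  also have "(\<lambda>n. \<Sum>j<p. ee (- (of_int m * of_nat j / of_nat p)) *
       (crank_coeff x (n - s) * ee (of_int n * ((z + of_nat j) / of_nat p)))) =
     (\<lambda>n. if int p dvd n - m then of_nat p * (crank_coeff x (n - s) * ee (of_int n * z / of_nat p)) else 0)"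
  proof
    fix n :: int
    have T: "ee (- (of_int m * of_nat j / of_nat p)) * (crank_coeff x (n - s) * ee (of_int n * ((z + of_nat j) / of_nat p)))
       = crank_coeff x (n - s) * ee (of_int n * z / of_nat p) * ee (of_int (n - m) * of_nat j / of_nat p)" for j
    proof -
      have "ee (- (of_int m * of_nat j / of_nat p)) * ee (of_int n * ((z + of_nat j) / of_nat p))
        = ee (of_int n * z / of_nat p) * ee (of_int (n - m) * of_nat j / of_nat p)"
        unfolding ee_add[symmetric] using p by (intro arg_cong[of _ _ ee]) (simp add: field_simps)
      thus ?thesis by (simp only: mult_ac)
    qed
    show "(\<Sum>j<p. ee (- (of_int m * of_nat j / of_nat p)) *
       (crank_coeff x (n - s) * ee (of_int n * ((z + of_nat j) / of_nat p)))) =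
      (if int p dvd n - m then of_nat p * (crank_coeff x (n - s) * ee (of_int n * z / of_nat p)) else 0)"
      unfolding T sum_distrib_left[symmetric] sum_roots_of_unity[OF p] by simp
  qed
  finally have "((\<lambda>n. of_nat p * (crank_coeff x (n - s) * ee (of_int n * z / of_nat p))) has_sum
       (\<Sum>j<p. ee (- (of_int m * of_nat j / of_nat p)) * S j)) (range (\<lambda>n. int p * n + m))"
  \<comment> \<open>Terms off the progression vanish, so the sum is restricted to the range of
    \<open>\<lambda>n. int p * n + m\<close> and then reindexed by \<open>n\<close>.\<close>
  proof (rule has_sum_cong_neutral[THEN iffD1, rotated -1])
    fix n :: int assume "n \<in> UNIV - range (\<lambda>n. int p * n + m)"
    hence "\<not> int p dvd n - m" by (auto simp: dvd_def image_def algebra_simps)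
    thus "(if int p dvd n - m then of_nat p * (crank_coeff x (n - s) * ee (of_int n * z / of_nat p)) else 0) = 0"
      by simp
  qed auto
  hence "((\<lambda>n. of_nat p * (crank_coeff x (int p * n + m - s) * ee (of_int (int p * n + m) * z / of_nat p))) has_sum
       (\<Sum>j<p. ee (- (of_int m * of_nat j / of_nat p)) * S j)) UNIV"
    using p by (subst (asm) has_sum_reindex) (auto simp: inj_on_def o_def)
  also have "(\<lambda>n. of_nat p * (crank_coeff x (int p * n + m - s) * ee (of_int (int p * n + m) * z / of_nat p))) =
     (\<lambda>n. (of_nat p * ee (of_int m / of_nat p * z)) * (crank_coeff x (int p * n + m - s) * ee (of_int n * z)))"
  proof
    fix n
    have "of_int (int p * n + m) * z / of_nat p = of_int m / of_nat p * z + of_int n * z"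
      using p by (simp add: field_simps)
    thus "of_nat p * (crank_coeff x (int p * n + m - s) * ee (of_int (int p * n + m) * z / of_nat p)) =
      (of_nat p * ee (of_int m / of_nat p * z)) * (crank_coeff x (int p * n + m - s) * ee (of_int n * z))"
      by (simp only: ee_add mult_ac)
  qed
  finally have "(\<Sum>\<^sub>\<infinity>n. crank_coeff x (int p * n + m - s) * ee (of_int n * z)) =
      (\<Sum>j<p. ee (- (of_int m * of_nat j / of_nat p)) * S j) / (of_nat p * ee (of_int m / of_nat p * z))"
    using p by (subst (asm) has_sum_cmult_right_iff) (auto dest: infsumI)
  hence "K_crank p m x z = E * (\<Sum>j<p. ee (- (of_int m * of_nat j / of_nat p)) * S j) / of_nat p"
    unfolding K_crank_def prod unfolding q1 s_def by simp
  thus ?thesis by (simp add: form sum_distrib_left mult_ac)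
qed

section \<open>Modular transformation of the crank forms\<close>

text \<open>Without its factor \<open>1 - ee v\<close>, the numerator of \<open>jac\<close> is the
  denominator of the crank generating function. That factor, combined with the half power, is the
  difference of exponentials on the right.\<close>

lemma crank_form_eq:
  assumes w: "Im w > 0" and v: "ee v \<noteq> 1"
  shows "crank_form p (ee v) w = eta_quot p w * (ee (v / 2) - ee (- (v / 2))) / jac v w"
proof -
  define q where "q = ee w"
  have q: "norm q < 1" unfolding q_def using w by (rule norm_ee_less_1)
  have E0: "euler_prod w \<noteq> 0" using w by (rule euler_prod_neq_0)
  define B where "B = qpoch (ee v * q) q * qpoch (inverse (ee v) * q) q"
  have "jac v w = - ee (- v / 2) * (1 - ee v) * B / euler_prod w ^ 2"
    unfolding jac_def q_def[symmetric] B_def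
    by (subst qpoch_rec[OF q]) (simp add: q_def ee_diff field_simps)
  also have "- ee (- v / 2) * (1 - ee v) = ee (v / 2) - ee (- (v / 2))"
    using ee_add[of "- v / 2" v] by (simp add: algebra_simps)
  finally have jac: "jac v w = (ee (v / 2) - ee (- (v / 2))) * B / euler_prod w ^ 2" .
  have "ee (v / 2) - ee (- (v / 2)) \<noteq> 0"
  proof
    assume "ee (v / 2) - ee (- (v / 2)) = 0"
    hence "ee (v / 2) * ee (v / 2) = 1" by (simp add: ee_minus field_simps)
    thus False using v by (simp add: ee_add[symmetric])
  qed
  thus ?thesis unfolding jac crank_form_def eta_quot_def crank_gf_def q_def[symmetric] B_def[symmetric]
    using E0 by (simp add: euler_prod_def q_def[symmetric] power2_eq_square)
qed

text \<open>\<open>eta_quot\<close> is invariant, so the whole transformation comes from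
  \<open>jac\<close> at \<open>1 / p\<close>. The lower right entry has the form
  \<open>d - p * j\<close> because such matrices arise when the translates of \<open>z / p\<close>
  are permuted.\<close>

lemma crank_form_modular:
  fixes w :: complex and \<alpha> \<beta> :: int and p d j :: nat
  assumes p: "prime p" "p > 3" and d: "1 \<le> d" "d \<le> p - 1" and w: "Im w > 0"
    and det: "\<alpha> * (int d - int p * int j) - \<beta> * int p ^ 2 = 1"
  defines "J \<equiv> of_nat p ^ 2 * w + of_int (int d - int p * int j)"
  shows "crank_form p (zeta p) ((of_int \<alpha> * w + of_int \<beta>) / J) =
    J * (of_real (sin (pi / real p) / sin (real d * pi / real p)) * (-1) ^ (d + 1)) * crank_form p (zeta p ^ d) w"
proof -
  have oddp: "odd p" using p prime_odd_nat[of p] by simp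
  define \<delta> where "\<delta> = int d - int p * int j"
  define \<tau> where "\<tau> = (of_int \<alpha> * w + of_int \<beta>) / J"
  have J: "of_int (int p * int p) * w + of_int \<delta> = J" by (simp add: J_def \<delta>_def power2_eq_square)
  have det': "\<alpha> * \<delta> - \<beta> * (int p * int p) = 1" using det by (simp add: \<delta>_def power2_eq_square)
  have J0: "J \<noteq> 0" and \<tau>: "Im \<tau> > 0"
    using Im_moebius_pos[OF w det'] unfolding J \<tau>_def by simp_all
  have ne1: "ee (of_nat l / of_nat p) \<noteq> 1" if "1 \<le> l" "l \<le> p - 1" for l
  proof
    assume "ee (of_nat l / of_nat p) = 1"
    then obtain n :: int where "of_nat l / of_nat p = (of_int n :: complex)" by (auto simp: ee_eq_1_iff)
    hence "(of_int (int l) :: complex) = of_int (n * int p)" using p by (simp add: field_simps)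
    hence "int l = n * int p" by (simp only: of_int_eq_iff)
    hence "int p dvd int l" by simp
    thus False using that p by (auto dest!: dvd_imp_le)
  qed
  have zeta: "zeta p ^ l = ee (of_nat l / of_nat p)" for l
    by (simp add: zeta_def ee_def exp_of_nat_mult[symmetric] mult_ac)
  have \<kappa>: "ee (of_nat l / of_nat p / 2) - ee (- (of_nat l / of_nat p / 2)) = 2 * \<i> * of_real (sin (real l * pi / real p))" for l
  proof -
    have "of_real (sin (real l * pi / real p)) = sin (of_nat l * of_real pi / of_nat p :: complex)"
      by (simp flip: sin_of_real)
    thus ?thesis by (simp add: sin_exp_eq ee_def field_simps)
  qed
  have jac: "jac (1 / of_nat p) \<tau> = inverse J * (-1) ^ (d + 1) * jac (of_nat d / of_nat p) w"
  proof -
    have "jac (of_nat 1 / of_nat p) ((of_int \<alpha> * w + of_int \<beta>) / (of_int (int p * int p) * w + of_int \<delta>)) =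
        inverse (of_int (int p * int p) * w + of_int \<delta>) * (-1) powi (int 1 * int p) *
        ee (- (of_nat 1 ^ 2 * of_int (int p) * of_int \<delta> / of_nat p) / 2) * jac (of_nat 1 * of_int \<delta> / of_nat p) w"
      using p by (intro jac_torsion_modular w det') auto
    hence "jac (1 / of_nat p) \<tau> = inverse J * (-1) powi (int p) * ee (of_int (- \<delta>) / 2) * jac (of_int \<delta> / of_nat p) w"
      using p unfolding J \<tau>_def by simp
    also have "of_int \<delta> / of_nat p = of_nat d / of_nat p + (of_int (- int j) :: complex)"
      using p by (simp add: \<delta>_def field_simps)
    also have "inverse J * (-1) powi (int p) * ee (of_int (- \<delta>) / 2) * jac (of_nat d / of_nat p + of_int (- int j)) w
       = inverse J * ((-1) powi (int p) * (-1) powi (- \<delta>) * (-1) powi (- int j)) * jac (of_nat d / of_nat p) w"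
      unfolding jac_plus_int ee_half_int by simp
    \<comment> \<open>As \<open>p\<close> is odd, \<open>\<delta> + j = d - p * j + j\<close> has
      the parity of \<open>d\<close>, so the dependence on \<open>j\<close> disappears.\<close>
    also have "(-1) powi (int p) * (-1) powi (- \<delta>) * (-1) powi (- int j) = ((-1) ^ (d + 1) :: complex)"
      using oddp by (auto simp: \<delta>_def minus_one_powi uminus_power_if)
    finally show ?thesis .
  qed
  have eta: "eta_quot p \<tau> = eta_quot p w"
    using eta_quot_modular[OF p w, of \<alpha> \<delta> \<beta>] det' by (simp add: \<tau>_def J_def \<delta>_def power2_eq_square)
  have e1: "ee (1 / of_nat p) \<noteq> 1" using ne1[of 1] p by simp
  have ed: "ee (of_nat d / of_nat p) \<noteq> 1" using ne1[of d] d by simp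
  have sd: "sin (real d * pi / real p) \<noteq> 0"
  proof
    assume "sin (real d * pi / real p) = 0"
    hence "ee (of_nat d / of_nat p / 2) = ee (- (of_nat d / of_nat p / 2))" using \<kappa>[of d] by simp
    hence "ee (of_nat d / of_nat p / 2) * ee (of_nat d / of_nat p / 2) = 1" by (simp add: ee_minus field_simps)
    thus False using ed by (simp add: ee_add[symmetric])
  qed
  have "crank_form p (zeta p) \<tau> = eta_quot p w * (2 * \<i> * of_real (sin (pi / real p))) /
      (inverse J * (-1) ^ (d + 1) * jac (of_nat d / of_nat p) w)"
    using crank_form_eq[OF \<tau> e1, of p] zeta[of 1] \<kappa>[of 1] by (simp add: jac eta)
  also have "\<dots> = J * (of_real (sin (pi / real p) / sin (real d * pi / real p)) * (-1) ^ (d + 1)) *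
      (eta_quot p w * (2 * \<i> * of_real (sin (real d * pi / real p))) / jac (of_nat d / of_nat p) w)"
    using sd J0 by (simp add: field_simps minus_one_power_iff)
  also have "eta_quot p w * (2 * \<i> * of_real (sin (real d * pi / real p))) / jac (of_nat d / of_nat p) w = crank_form p (zeta p ^ d) w"
    unfolding zeta crank_form_eq[OF w ed] \<kappa> ..
  finally show ?thesis by (simp add: \<tau>_def)
qed

section \<open>Action of the matrix on the average over translates\<close>

theorem theorem3p1:
  fixes p m a d :: nat and k :: int and z :: complex
  assumes "prime p" and "p > 3"
    and "m \<le> p - 1"
    and "1 \<le> a" and "a \<le> p - 1" and "1 \<le> d" and "d \<le> p - 1"
    and "int a * int d - k * int p = 1"
    and "Im z > 0"
  shows "slash1 (int a) k (int p) (int d) (K_crank p (int m) (zeta p)) z =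
         complex_of_real (sin (pi / real p) / sin (real d * pi / real p)) * (-1) ^ (d + 1)
         * zeta p powi (int m * int a * k) * K_crank p (int m * int a ^ 2) (zeta p ^ d) z"
proof -
  note p = assms(1,2) and det = assms(8) and z = assms(9)
  have p0: "p > 0" using p by simp
  define J where "J = of_nat p * z + of_nat d"
  define Az where "Az = (of_nat a * z + of_int k) / J"
  define c where "c = complex_of_real (sin (pi / real p) / sin (real d * pi / real p)) * (-1) ^ (d + 1)"
  have Az: "Im Az > 0" and J0: "J \<noteq> 0"
    using Im_moebius_pos[OF z, of "int a" "int d" k "int p"] det by (auto simp: Az_def J_def)
  have zeta: "zeta p powi n = ee (of_int n / of_nat p)" for n
    by (simp add: zeta_def ee_def exp_power_int mult_ac)
  have nz: "norm (zeta p ^ l) = 1" for l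
    by (simp add: zeta_def norm_power)
  have nd: "\<not> int p dvd int d" using assms by (auto dest!: dvd_imp_le)
  \<comment> \<open>The index \<open>j' = r j\<close> solves \<open>a * j' = k + j * d\<close>
    modulo \<open>p\<close>, where \<open>d\<close> is the inverse of \<open>a\<close>. This is the
    condition for the translate \<open>(Az + j) / p\<close> to be an image of
    \<open>(z + j') / p\<close> under an integral matrix.\<close>
  define r where "r j = nat ((int d * k + int j * int d ^ 2) mod int p)" for j
  have rmod: "int (r j) = (int d * k + int j * int d ^ 2) mod int p" for j
    using p0 by (simp add: r_def)
  have rdvd: "int p dvd int d * k + int j * int d ^ 2 - int (r j)" for j
    unfolding rmod by (simp add: mod_eq_dvd_iff[symmetric])
  have bij: "bij_betw r {..<p} {..<p}"
  proof -
    have "r ` {..<p} \<subseteq> {..<p}" using p0 by (auto simp: r_def nat_less_iff)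
    moreover have "inj_on r {..<p}"
    proof (rule inj_onI)
      fix x y assume xy: "x \<in> {..<p}" "y \<in> {..<p}" "r x = r y"
      have "(int d * k + int x * int d ^ 2) mod int p = (int d * k + int y * int d ^ 2) mod int p"
        unfolding rmod[symmetric] xy(3) ..
      hence "int p dvd (int d * k + int x * int d ^ 2) - (int d * k + int y * int d ^ 2)"
        by (simp only: mod_eq_dvd_iff)
      hence "int p dvd (int x - int y) * (int d * int d)" by (simp add: algebra_simps power2_eq_square)
      hence "int p dvd int x - int y"
        using nd p prime_dvd_mult_iff[of "int p"] by auto
      hence "int x - int y = 0" using dvd_imp_le_int[of "int x - int y" "int p"] xy by force
      thus "x = y" by simp
    qed
    ultimately show ?thesis by (simp add: bij_betw_def endo_inj_surj)
  qed
  have summand: "ee (- (of_int (int m) * of_nat j / of_nat p)) * crank_form p (zeta p) ((Az + of_nat j) / of_nat p) =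
     J * c * ee (of_int (int m * int a * k) / of_nat p) *
     (ee (- (of_int (int m * int a ^ 2) * of_nat (r j) / of_nat p)) * crank_form p (zeta p ^ d) ((z + of_nat (r j)) / of_nat p))"
    if j: "j < p" for j
  proof -
    define j' where "j' = r j"
    \<comment> \<open>The entries come from the factorisation \<open>[1, j; 0, p] * [a, k; p, d] =
      [\<alpha>, \<beta>; p^2, \<delta>] * [1, j'; 0, p]\<close>, which also determines
      \<open>\<beta>\<close> below.\<close>
    define \<alpha> \<delta> where "\<alpha> = int a + int j * int p" and "\<delta> = int d - int p * int j'"
    define w where "w = (z + of_nat j') / of_nat p"
    have w: "Im w > 0" using z p0 by (simp add: w_def)
    from rdvd[of j] obtain t where t: "int j' = int d * k + int j * int d ^ 2 - int p * t"
      unfolding j'_def by (metis dvdE diff_diff_eq2 diff_add_cancel add_diff_cancel_left' add.commute)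
    have ad: "int a * int d = 1 + k * int p" using det by simp
    have "int p dvd k + int j * int d - \<alpha> * int j'"
    proof -
      have "k + int j * int d - \<alpha> * int j' = k + int j * int d - (int a * int d) * k - int j * int d * (int a * int d)
         + int p * (int a * t - int j * int j')"
        by (simp add: \<alpha>_def t algebra_simps power2_eq_square)
      also have "\<dots> = int p * (int a * t - int j * int j' - k * k - int j * int d * k)"
        unfolding ad by (simp add: algebra_simps)
      finally show ?thesis by simp
    qed
    then obtain \<beta> where \<beta>: "k + int j * int d - \<alpha> * int j' = int p * \<beta>" by blast
    have det2: "\<alpha> * (int d - int p * int j') - \<beta> * int p ^ 2 = 1"
    proof -
      have "\<alpha> * (int d - int p * int j') - \<beta> * int p ^ 2 = \<alpha> * int d - int p * (\<alpha> * int j' + int p * \<beta>)"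
        by (simp add: algebra_simps power2_eq_square)
      also have "\<dots> = int a * int d - k * int p"
        unfolding \<beta>[symmetric] by (simp add: \<alpha>_def algebra_simps)
      finally show ?thesis using det by simp
    qed
    \<comment> \<open>The automorphy factor is the same for every \<open>j\<close>, so it leaves the
      sum and cancels against the weight of the slash operator.\<close>
    have J': "of_nat p ^ 2 * w + of_int (int d - int p * int j') = J"
      using p0 by (simp add: w_def J_def field_simps power2_eq_square)
    have \<beta>': "of_int k + of_nat j * of_nat d - of_int \<alpha> * of_nat j' = (of_nat p * of_int \<beta> :: complex)"
      using arg_cong[OF \<beta>, of "of_int :: int \<Rightarrow> complex"] by simp
    have "of_nat p * (of_int \<alpha> * w + of_int \<beta>) = of_int \<alpha> * (z + of_nat j') + of_nat p * of_int \<beta>"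
      using p0 by (simp add: w_def field_simps)
    also have "\<dots> = (of_nat a * z + of_int k) + of_nat j * J"
      unfolding \<beta>'[symmetric] by (simp add: \<alpha>_def J_def algebra_simps)
    also have "\<dots> = (Az + of_nat j) * J" using J0 by (simp add: Az_def field_simps)
    finally have eq: "(Az + of_nat j) / of_nat p = (of_int \<alpha> * w + of_int \<beta>) / J"
      using J0 p0 by (simp add: field_simps)
    have cf: "crank_form p (zeta p) ((Az + of_nat j) / of_nat p) = J * c * crank_form p (zeta p ^ d) w"
      unfolding eq using crank_form_modular[OF p assms(6,7) w det2] unfolding J' c_def .
    \<comment> \<open>From \<open>a * d = 1\<close> modulo \<open>p\<close> one gets
      \<open>a^2 * j' = a * k + j\<close>. Hence the character of \<open>j\<close> for
      \<open>m\<close> becomes that of \<open>j'\<close> for \<open>m * a^2\<close>, times the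
      constant phase of the theorem.\<close>
    have "int p dvd (- (int m * int j)) - (int m * int a * k - int m * int a ^ 2 * int j')"
    proof -
      have "(- (int m * int j)) - (int m * int a * k - int m * int a ^ 2 * int j') =
         int m * ((int a * int d) * (int a * k) - int a * k + int j * ((int a * int d) * (int a * int d)) - int j)
         - int p * (int m * int a ^ 2 * t)"
        by (simp add: t algebra_simps power2_eq_square)
      also have "\<dots> = int p * (int m * (int a * k * k + int j * (2 * k + k * k * int p)) - int m * int a ^ 2 * t)"
        unfolding ad by (simp add: algebra_simps)
      finally show ?thesis by simp
    qed
    from ee_cong[OF this p0]
    have "ee (- (of_int (int m) * of_nat j / of_nat p)) =
       ee (of_int (int m * int a * k) / of_nat p) * ee (- (of_int (int m * int a ^ 2) * of_nat j' / of_nat p))"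
      unfolding ee_add[symmetric] by (simp add: diff_divide_distrib)
    thus ?thesis unfolding cf j'_def[symmetric] w_def[symmetric] by (simp add: mult_ac)
  qed
  define f where "f j = ee (- (of_int (int m * int a ^ 2) * of_nat j / of_nat p)) * crank_form p (zeta p ^ d) ((z + of_nat j) / of_nat p)" for j
  have "slash1 (int a) k (int p) (int d) (K_crank p (int m) (zeta p)) z = inverse J * K_crank p (int m) (zeta p) Az"
    by (simp add: slash1_def J_def Az_def)
  also have "\<dots> = inverse J * ((\<Sum>j<p. J * c * ee (of_int (int m * int a * k) / of_nat p) * f (r j)) / of_nat p)"
    using K_crank_eq_sum[OF _ Az p0, of "zeta p" "int m"] nz[of 1] summand by (simp add: f_def)
  also have "\<dots> = c * ee (of_int (int m * int a * k) / of_nat p) * ((\<Sum>j<p. f (r j)) / of_nat p)"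
    unfolding sum_distrib_left[symmetric] using J0 by simp
  also have "(\<Sum>j<p. f (r j)) = (\<Sum>j<p. f j)" by (rule sum.reindex_bij_betw[OF bij])
  also have "(\<Sum>j<p. f j) / of_nat p = K_crank p (int m * int a ^ 2) (zeta p ^ d) z"
    using K_crank_eq_sum[OF nz[of d] z p0, of "int m * int a ^ 2"] by (simp add: f_def)
  finally show ?thesis by (simp add: c_def zeta mult_ac)
qed

end
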